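(* Let $R$ be a ring and let $M$ be a left $R$-module which is projective in $\sigma[M]$. If $M$ is co-semisimple and a Goldie module, then for every fully invariant submodule $N\le M$ the factor module $M/N$ is a semiprime Goldie module.
   Context: Rings are associative with unit and modules are left unital modules. $\sigma[M]$ is the full subcategory of $R$-Mod of $M$-subgenerated modules (submodules of quotients of direct sums of copies of $M$). "Projective in $\sigma[M]$" means that $\mathrm{Hom}_R(M,-)$ is exact on short exact sequences in $\sigma[M]$. A module $A$ is $M$-injective if every homomorphism from a submodule of $M$ to $A$ extends to $M$. $M$ is co-semisimple if every simple module in $\sigma[M]$ is $M$-injective. For any module $X$: a submodule $N\le X$ is fully invariant, $N\leq_{FI}X$, if $f(N)\le N$ for all $f\in \mathrm{End}_R(X)$; for $N,K\le X$, the product is $N_XK=\sum\{f(N)\mid f\in \mathrm{Hom}_R(X,K)\}$; $X$ is semiprime if whenever $K\leq_{FI}X$ and $K_XK=0$, then $K=0$; a left annihilator in $X$ is a submodule of the form $\bigcap_{f\in Y}\mathrm{Ker}(f)$ for some $Y\subseteq \mathrm{End}_R(X)$; $X$ is a Goldie module if it satisfies ACC on left annihilators and has finite uniform dimension. *)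

theory Defs
  imports "HOL-Algebra.Module" "HOL-Algebra.AbelCoset"
begin

text \<open>
  The library locale \<open>module\<close> requires a commutative ring of scalars. Here \<open>R\<close> is an arbitrary
  unital ring; the record of modules and the locale \<open>submodule\<close> (which does not mention
  commutativity) are taken from the library. The ring multiplication and unit that a
  \<open>module\<close> record inherits from \<open>ring\<close> play no role.
\<close>

locale left_module = R?: ring R + M?: abelian_group M
  for R :: "('a, 'r) ring_scheme" (structure) and M :: "('a, 'b, 'm) module_scheme" (structure) +
  assumes smult_closed [simp, intro]:
      "\<lbrakk>a \<in> carrier R; x \<in> carrier M\<rbrakk> \<Longrightarrow> a \<odot>\<^bsub>M\<^esub> x \<in> carrier M"
    and smult_l_distr:
      "\<lbrakk>a \<in> carrier R; b \<in> carrier R; x \<in> carrier M\<rbrakk> \<Longrightarrow>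
       (a \<oplus>\<^bsub>R\<^esub> b) \<odot>\<^bsub>M\<^esub> x = a \<odot>\<^bsub>M\<^esub> x \<oplus>\<^bsub>M\<^esub> b \<odot>\<^bsub>M\<^esub> x"
    and smult_r_distr:
      "\<lbrakk>a \<in> carrier R; x \<in> carrier M; y \<in> carrier M\<rbrakk> \<Longrightarrow>
       a \<odot>\<^bsub>M\<^esub> (x \<oplus>\<^bsub>M\<^esub> y) = a \<odot>\<^bsub>M\<^esub> x \<oplus>\<^bsub>M\<^esub> a \<odot>\<^bsub>M\<^esub> y"
    and smult_assoc1:
      "\<lbrakk>a \<in> carrier R; b \<in> carrier R; x \<in> carrier M\<rbrakk> \<Longrightarrow>
       (a \<otimes>\<^bsub>R\<^esub> b) \<odot>\<^bsub>M\<^esub> x = a \<odot>\<^bsub>M\<^esub> (b \<odot>\<^bsub>M\<^esub> x)"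
    and smult_one [simp]:
      "x \<in> carrier M \<Longrightarrow> \<one>\<^bsub>R\<^esub> \<odot>\<^bsub>M\<^esub> x = x"

text \<open>Homomorphisms are extensional functions, so that equality of homomorphisms is equality in HOL.\<close>

definition lmod_hom ::
  "('a, 'r) ring_scheme \<Rightarrow> ('a, 'b, 'm) module_scheme \<Rightarrow> ('a, 'c, 'n) module_scheme \<Rightarrow> ('b \<Rightarrow> 'c) set"
  where "lmod_hom R A B =
    {f \<in> carrier A \<rightarrow>\<^sub>E carrier B.
       (\<forall>x\<in>carrier A. \<forall>y\<in>carrier A. f (x \<oplus>\<^bsub>A\<^esub> y) = f x \<oplus>\<^bsub>B\<^esub> f y) \<and>
       (\<forall>r\<in>carrier R. \<forall>x\<in>carrier A. f (r \<odot>\<^bsub>A\<^esub> x) = r \<odot>\<^bsub>B\<^esub> f x)}"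

abbreviation lmod_end :: "('a, 'r) ring_scheme \<Rightarrow> ('a, 'b, 'm) module_scheme \<Rightarrow> ('b \<Rightarrow> 'b) set"
  where "lmod_end R A \<equiv> lmod_hom R A A"

definition quot_module ::
  "('a, 'b, 'm) module_scheme \<Rightarrow> 'b set \<Rightarrow> ('a, 'b set) module"
  where "quot_module M N =
    \<lparr>carrier = a_rcosets\<^bsub>M\<^esub> N, mult = undefined, one = undefined,
     zero = N, add = set_add M,
     smult = (\<lambda>r X. \<Union>x\<in>X. N +>\<^bsub>M\<^esub> (r \<odot>\<^bsub>M\<^esub> x))\<rparr>"

definition copower_module ::
  "('a, 'b, 'm) module_scheme \<Rightarrow> 'i set \<Rightarrow> ('a, 'i \<Rightarrow> 'b) module"
  where "copower_module M I =
    \<lparr>carrier = {x \<in> I \<rightarrow>\<^sub>E carrier M. finite {i \<in> I. x i \<noteq> \<zero>\<^bsub>M\<^esub>}},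
     mult = undefined, one = undefined,
     zero = (\<lambda>i\<in>I. \<zero>\<^bsub>M\<^esub>),
     add = (\<lambda>x y. \<lambda>i\<in>I. x i \<oplus>\<^bsub>M\<^esub> y i),
     smult = (\<lambda>r x. \<lambda>i\<in>I. r \<odot>\<^bsub>M\<^esub> x i)\<rparr>"

text \<open>
  \<open>in_sigma R M A\<close>: the module \<open>A\<close> belongs to \<open>\<sigma>[M]\<close>, i.e. \<open>A\<close> is isomorphic to a submodule of a
  quotient of a direct sum of copies of \<open>M\<close>.
  Taking index sets inside \<open>nat \<times> 'c\<close>, where \<open>'c\<close> is the type of elements of \<open>A\<close>, is no
  restriction: if \<open>A\<close> embeds into \<open>M\<^bsup>(I)\<^esup> / K\<close> for any set \<open>I\<close>, choose for each \<open>a \<in> A\<close> a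
  representative of its image and let \<open>I' \<subseteq> I\<close> be the union of the finite supports of these
  representatives. Then \<open>I'\<close> injects into \<open>nat \<times> 'c\<close>, and \<open>A\<close> embeds into
  \<open>M\<^bsup>(I')\<^esup> / (K \<inter> M\<^bsup>(I')\<^esup>)\<close>.
\<close>

definition in_sigma ::
  "('a, 'r) ring_scheme \<Rightarrow> ('a, 'b, 'm) module_scheme \<Rightarrow> ('a, 'c, 'n) module_scheme \<Rightarrow> bool"
  where "in_sigma R M A \<longleftrightarrow> left_module R A \<and>
    (\<exists>(I :: (nat \<times> 'c) set) K h.
       submodule K R (copower_module M I) \<and>
       h \<in> lmod_hom R A (quot_module (copower_module M I) K) \<and>
       inj_on h (carrier A))"

definition short_exact ::
  "('a, 'r) ring_scheme \<Rightarrow> ('a, 'c, 'm) module_scheme \<Rightarrow> ('a, 'd, 'n) module_scheme \<Rightarrow>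
   ('a, 'e, 'o) module_scheme \<Rightarrow> ('c \<Rightarrow> 'd) \<Rightarrow> ('d \<Rightarrow> 'e) \<Rightarrow> bool"
  where "short_exact R A B C f g \<longleftrightarrow>
    f \<in> lmod_hom R A B \<and> g \<in> lmod_hom R B C \<and>
    inj_on f (carrier A) \<and>
    f ` carrier A = {y \<in> carrier B. g y = \<zero>\<^bsub>C\<^esub>} \<and>
    g ` carrier B = carrier C"

text \<open>Exactness of \<open>0 \<rightarrow> Hom(M,A) \<rightarrow> Hom(M,B) \<rightarrow> Hom(M,C) \<rightarrow> 0\<close>.\<close>

definition hom_short_exact ::
  "('a, 'r) ring_scheme \<Rightarrow> ('a, 'b, 'l) module_scheme \<Rightarrow>
   ('a, 'c, 'm) module_scheme \<Rightarrow> ('a, 'd, 'n) module_scheme \<Rightarrow>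
   ('a, 'e, 'o) module_scheme \<Rightarrow> ('c \<Rightarrow> 'd) \<Rightarrow> ('d \<Rightarrow> 'e) \<Rightarrow> bool"
  where "hom_short_exact R M A B C f g \<longleftrightarrow>
    inj_on (compose (carrier M) f) (lmod_hom R M A) \<and>
    compose (carrier M) f ` lmod_hom R M A =
      {u \<in> lmod_hom R M B. compose (carrier M) g u = (\<lambda>x\<in>carrier M. \<zero>\<^bsub>C\<^esub>)} \<and>
    compose (carrier M) g ` lmod_hom R M B = lmod_hom R M C"

text \<open>
  A definition in HOL cannot quantify over modules on all types, so modules in \<open>\<sigma>[M]\<close> are
  quantified over with carrier contained in the type \<open>('a + 'b + nat) set\<close>, where \<open>'a\<close> and \<open>'b\<close>
  are the types of scalars and of elements of \<open>M\<close>. As long as isomorphic copies of all modules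
  of cardinality at most \<open>\<kappa> = max(|R|, |M|, \<aleph>\<^sub>0)\<close> are available, this gives the usual notions:

  \<^item> Projectivity. Only surjectivity of \<open>Hom(M,B) \<rightarrow> Hom(M,C)\<close> is at issue. Given an epimorphism
    \<open>g : B \<rightarrow> C\<close> in \<open>\<sigma>[M]\<close> with \<open>B\<close>, \<open>C\<close> of any size and \<open>u : M \<rightarrow> C\<close>, replace \<open>C\<close> by \<open>u(M)\<close> and \<open>B\<close>
    by the submodule generated by one chosen preimage of each element of \<open>u(M)\<close>. All modules
    of the resulting short exact sequence lie in \<open>\<sigma>[M]\<close> and have cardinality at most \<open>\<kappa>\<close>, and
    a lift of \<open>u\<close> for it is a lift for the original one.

  \<^item> Co-semisimplicity. A simple module is cyclic, hence of cardinality at most \<open>|R|\<close>.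
\<close>

type_synonym ('a, 'b) sigma_elem = "('a + 'b + nat) set"

definition projective_in_sigma :: "('a, 'r) ring_scheme \<Rightarrow> ('a, 'b, 'm) module_scheme \<Rightarrow> bool"
  where "projective_in_sigma R M \<longleftrightarrow>
    (\<forall>(A :: ('a, ('a, 'b) sigma_elem) module) (B :: ('a, ('a, 'b) sigma_elem) module)
      (C :: ('a, ('a, 'b) sigma_elem) module) f g.
       in_sigma R M A \<longrightarrow> in_sigma R M B \<longrightarrow> in_sigma R M C \<longrightarrow>
       short_exact R A B C f g \<longrightarrow> hom_short_exact R M A B C f g)"

definition relatively_injective ::
  "('a, 'r) ring_scheme \<Rightarrow> ('a, 'b, 'm) module_scheme \<Rightarrow> ('a, 'c, 'n) module_scheme \<Rightarrow> bool"
  where "relatively_injective R M A \<longleftrightarrow>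
    (\<forall>L f. submodule L R M \<longrightarrow> f \<in> lmod_hom R (M\<lparr>carrier := L\<rparr>) A \<longrightarrow>
       (\<exists>g\<in>lmod_hom R M A. \<forall>x\<in>L. g x = f x))"

definition simple_module :: "('a, 'r) ring_scheme \<Rightarrow> ('a, 'b, 'm) module_scheme \<Rightarrow> bool"
  where "simple_module R A \<longleftrightarrow> left_module R A \<and> carrier A \<noteq> {\<zero>\<^bsub>A\<^esub>} \<and>
    (\<forall>L. submodule L R A \<longrightarrow> L = {\<zero>\<^bsub>A\<^esub>} \<or> L = carrier A)"

definition co_semisimple :: "('a, 'r) ring_scheme \<Rightarrow> ('a, 'b, 'm) module_scheme \<Rightarrow> bool"
  where "co_semisimple R M \<longleftrightarrow>
    (\<forall>S :: ('a, ('a, 'b) sigma_elem) module.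
       simple_module R S \<longrightarrow> in_sigma R M S \<longrightarrow> relatively_injective R M S)"

definition fully_invariant ::
  "('a, 'r) ring_scheme \<Rightarrow> ('a, 'b, 'm) module_scheme \<Rightarrow> 'b set \<Rightarrow> bool"
  where "fully_invariant R X N \<longleftrightarrow> submodule N R X \<and> (\<forall>f\<in>lmod_end R X. f ` N \<subseteq> N)"

text \<open>The sum of a family of submodules, as the least submodule containing all of them.\<close>

definition submodule_sum ::
  "('a, 'r) ring_scheme \<Rightarrow> ('a, 'b, 'm) module_scheme \<Rightarrow> 'b set set \<Rightarrow> 'b set"
  where "submodule_sum R X \<U> = \<Inter>{L. submodule L R X \<and> \<Union>\<U> \<subseteq> L}"

definition submodule_prod ::
  "('a, 'r) ring_scheme \<Rightarrow> ('a, 'b, 'm) module_scheme \<Rightarrow> 'b set \<Rightarrow> 'b set \<Rightarrow> 'b set"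
  where "submodule_prod R X N K =
    submodule_sum R X {f ` N | f. f \<in> lmod_hom R X (X\<lparr>carrier := K\<rparr>)}"

definition semiprime_module :: "('a, 'r) ring_scheme \<Rightarrow> ('a, 'b, 'm) module_scheme \<Rightarrow> bool"
  where "semiprime_module R X \<longleftrightarrow>
    (\<forall>K. fully_invariant R X K \<longrightarrow> submodule_prod R X K K = {\<zero>\<^bsub>X\<^esub>} \<longrightarrow> K = {\<zero>\<^bsub>X\<^esub>})"

definition left_annihilator ::
  "('a, 'r) ring_scheme \<Rightarrow> ('a, 'b, 'm) module_scheme \<Rightarrow> 'b set \<Rightarrow> bool"
  where "left_annihilator R X L \<longleftrightarrow>
    (\<exists>Y \<subseteq> lmod_end R X. L = {x \<in> carrier X. \<forall>f\<in>Y. f x = \<zero>\<^bsub>X\<^esub>})"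

definition acc_left_annihilators ::
  "('a, 'r) ring_scheme \<Rightarrow> ('a, 'b, 'm) module_scheme \<Rightarrow> bool"
  where "acc_left_annihilators R X \<longleftrightarrow>
    (\<forall>L :: nat \<Rightarrow> 'b set. (\<forall>n. left_annihilator R X (L n)) \<longrightarrow> (\<forall>n. L n \<subseteq> L (Suc n)) \<longrightarrow>
       (\<exists>n. \<forall>m\<ge>n. L m = L n))"

text \<open>Finite uniform dimension: there is no infinite direct sum of nonzero submodules.\<close>

definition independent_submodules ::
  "('a, 'r) ring_scheme \<Rightarrow> ('a, 'b, 'm) module_scheme \<Rightarrow> 'b set set \<Rightarrow> bool"
  where "independent_submodules R X \<U> \<longleftrightarrow>
    (\<forall>U\<in>\<U>. submodule U R X \<and> U \<inter> submodule_sum R X (\<U> - {U}) = {\<zero>\<^bsub>X\<^esub>})"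

definition finite_uniform_dim :: "('a, 'r) ring_scheme \<Rightarrow> ('a, 'b, 'm) module_scheme \<Rightarrow> bool"
  where "finite_uniform_dim R X \<longleftrightarrow>
    (\<forall>\<U>. independent_submodules R X \<U> \<longrightarrow> {\<zero>\<^bsub>X\<^esub>} \<notin> \<U> \<longrightarrow> finite \<U>)"

definition goldie_module :: "('a, 'r) ring_scheme \<Rightarrow> ('a, 'b, 'm) module_scheme \<Rightarrow> bool"
  where "goldie_module R X \<longleftrightarrow> acc_left_annihilators R X \<and> finite_uniform_dim R X"

end

theory Submission
  imports Defs
begin

text \<open>
  Let \<open>P \<subseteq> M\<close> be a submodule and \<open>x \<notin> P\<close>. A submodule \<open>L\<close> of \<open>B = P + Rx\<close> which contains \<open>P\<close> and is
  maximal among those avoiding \<open>x\<close> gives a simple module \<open>B/L\<close>; co-semisimplicity extends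
  \<open>B \<rightarrow> B/L\<close> to \<open>M\<close>, and projectivity lifts this extension to an endomorphism \<open>h : M \<rightarrow> B\<close> with
  \<open>h x \<notin> P\<close>. For \<open>P = N\<close> fully invariant, \<open>h\<close> induces an endomorphism of \<open>M/N\<close>, so \<open>M/N\<close> is
  semiprime.

  For \<open>P = 0\<close>, the ascending chain condition yields in each nonzero \<open>U\<close> a nonzero
  \<open>c : M \<rightarrow> U\<close> that is injective on its image, and finite uniform dimension allows one to add up
  such maps to a monomorphism \<open>f : M \<rightarrow> P\<close> for every essential \<open>P\<close>. If \<open>P\<close> is moreover fully invariant,
  then \<open>P = M\<close>: otherwise take \<open>0 \<noteq> g : M \<rightarrow> S\<close> with \<open>S\<close> simple and \<open>g P = 0\<close>, extend \<open>g\<close> along \<open>f\<close>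
  to \<open>h : M \<rightarrow> S\<close> with \<open>h f = g\<close>, and lift \<open>h = g u\<close>; then \<open>h P \<subseteq> g P = 0\<close> and so \<open>g = h f = 0\<close>.
  Applied to the sum of \<open>N\<close> and its annihilator, this makes \<open>N\<close> a direct summand, and the Goldie
  conditions pass to the summand \<open>M/N\<close>.
\<close>

section \<open>Linear maps, submodules and quotients\<close>

text \<open>Linearity without the extensionality built into \<open>lmod_hom\<close>, so that
  composites and restrictions to submodules remain plain functions. \<open>lmod_hom_map\<close> and
  \<open>lmod_hom_restrict\<close> pass between the two notions.\<close>

definition lmod_map ::
  "('a, 'r) ring_scheme \<Rightarrow> ('a, 'b, 'm) module_scheme \<Rightarrow> ('a, 'c, 'n) module_scheme \<Rightarrow> ('b \<Rightarrow> 'c) \<Rightarrow> bool"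
  where "lmod_map R A B f \<longleftrightarrow>
    (\<forall>x\<in>carrier A. f x \<in> carrier B) \<and>
    (\<forall>x\<in>carrier A. \<forall>y\<in>carrier A. f (x \<oplus>\<^bsub>A\<^esub> y) = f x \<oplus>\<^bsub>B\<^esub> f y) \<and>
    (\<forall>r\<in>carrier R. \<forall>x\<in>carrier A. f (r \<odot>\<^bsub>A\<^esub> x) = r \<odot>\<^bsub>B\<^esub> f x)"

lemma lmod_mapD:
  assumes "lmod_map R A B f"
  shows "x \<in> carrier A \<Longrightarrow> f x \<in> carrier B"
    and "\<lbrakk>x \<in> carrier A; y \<in> carrier A\<rbrakk> \<Longrightarrow> f (x \<oplus>\<^bsub>A\<^esub> y) = f x \<oplus>\<^bsub>B\<^esub> f y"
    and "\<lbrakk>r \<in> carrier R; x \<in> carrier A\<rbrakk> \<Longrightarrow> f (r \<odot>\<^bsub>A\<^esub> x) = r \<odot>\<^bsub>B\<^esub> f x"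
  using assms unfolding lmod_map_def by auto

lemma lmod_mapI:
  assumes "\<And>x. x \<in> carrier A \<Longrightarrow> f x \<in> carrier B"
    and "\<And>x y. \<lbrakk>x \<in> carrier A; y \<in> carrier A\<rbrakk> \<Longrightarrow> f (x \<oplus>\<^bsub>A\<^esub> y) = f x \<oplus>\<^bsub>B\<^esub> f y"
    and "\<And>r x. \<lbrakk>r \<in> carrier R; x \<in> carrier A\<rbrakk> \<Longrightarrow> f (r \<odot>\<^bsub>A\<^esub> x) = r \<odot>\<^bsub>B\<^esub> f x"
  shows "lmod_map R A B f"
  using assms unfolding lmod_map_def by auto

lemma lmod_hom_map: "f \<in> lmod_hom R A B \<Longrightarrow> lmod_map R A B f"
  unfolding lmod_map_def lmod_hom_def by auto

lemma lmod_map_comp: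
  "lmod_map R A B f \<Longrightarrow> lmod_map R B C g \<Longrightarrow> lmod_map R A C (\<lambda>x. g (f x))"
  unfolding lmod_map_def by simp

lemma lmod_map_sub:
  "lmod_map R A B f \<Longrightarrow> L \<subseteq> carrier A \<Longrightarrow> lmod_map R (A\<lparr>carrier := L\<rparr>) B f"
  unfolding lmod_map_def by (auto simp: subset_iff)

lemma lmod_map_into:
  "lmod_map R A B f \<Longrightarrow> (\<And>x. x \<in> carrier A \<Longrightarrow> f x \<in> L) \<Longrightarrow> lmod_map R A (B\<lparr>carrier := L\<rparr>) f"
  unfolding lmod_map_def by auto

lemma lmod_map_from_into:
  "lmod_map R A (B\<lparr>carrier := L\<rparr>) f \<Longrightarrow> L \<subseteq> carrier B \<Longrightarrow> lmod_map R A B f"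
  unfolding lmod_map_def by auto

lemma left_moduleI:
  fixes R (structure) and M (structure)
  assumes "ring R" "abelian_group M"
    "\<And>a x. \<lbrakk>a \<in> carrier R; x \<in> carrier M\<rbrakk> \<Longrightarrow> a \<odot>\<^bsub>M\<^esub> x \<in> carrier M"
    "\<And>a b x. \<lbrakk>a \<in> carrier R; b \<in> carrier R; x \<in> carrier M\<rbrakk> \<Longrightarrow>
       (a \<oplus>\<^bsub>R\<^esub> b) \<odot>\<^bsub>M\<^esub> x = a \<odot>\<^bsub>M\<^esub> x \<oplus>\<^bsub>M\<^esub> b \<odot>\<^bsub>M\<^esub> x"
    "\<And>a x y. \<lbrakk>a \<in> carrier R; x \<in> carrier M; y \<in> carrier M\<rbrakk> \<Longrightarrow>
       a \<odot>\<^bsub>M\<^esub> (x \<oplus>\<^bsub>M\<^esub> y) = a \<odot>\<^bsub>M\<^esub> x \<oplus>\<^bsub>M\<^esub> a \<odot>\<^bsub>M\<^esub> y"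
    "\<And>a b x. \<lbrakk>a \<in> carrier R; b \<in> carrier R; x \<in> carrier M\<rbrakk> \<Longrightarrow>
       (a \<otimes>\<^bsub>R\<^esub> b) \<odot>\<^bsub>M\<^esub> x = a \<odot>\<^bsub>M\<^esub> (b \<odot>\<^bsub>M\<^esub> x)"
    "\<And>x. x \<in> carrier M \<Longrightarrow> \<one>\<^bsub>R\<^esub> \<odot>\<^bsub>M\<^esub> x = x"
  shows "left_module R M"
  by (intro left_module.intro left_module_axioms.intro assms)

section \<open>Submodules, kernels, images and restricted carriers\<close>

context left_module
begin

lemma smult_l_null [simp]: "x \<in> carrier M \<Longrightarrow> \<zero>\<^bsub>R\<^esub> \<odot>\<^bsub>M\<^esub> x = \<zero>\<^bsub>M\<^esub>"
  by (metis R.l_zero R.zero_closed M.add.r_cancel_one' smult_closed smult_l_distr)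

lemma smult_r_null [simp]: "a \<in> carrier R \<Longrightarrow> a \<odot>\<^bsub>M\<^esub> \<zero>\<^bsub>M\<^esub> = \<zero>\<^bsub>M\<^esub>"
  by (metis M.l_zero M.zero_closed M.add.r_cancel_one' smult_closed smult_r_distr)

lemma smult_minus_one: "x \<in> carrier M \<Longrightarrow> (\<ominus>\<^bsub>R\<^esub> \<one>\<^bsub>R\<^esub>) \<odot>\<^bsub>M\<^esub> x = \<ominus>\<^bsub>M\<^esub> x"
proof -
  assume x: "x \<in> carrier M"
  have "(\<ominus>\<^bsub>R\<^esub> \<one>\<^bsub>R\<^esub>) \<odot>\<^bsub>M\<^esub> x \<oplus>\<^bsub>M\<^esub> \<one>\<^bsub>R\<^esub> \<odot>\<^bsub>M\<^esub> x = \<zero>\<^bsub>M\<^esub>"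
    using x by (simp add: smult_l_distr[symmetric] R.l_neg del: smult_one)
  then show ?thesis using x by (simp add: M.minus_equality)
qed

text \<open>Negation is multiplication by -1, so closure under additive inverses follows from
  closure under scalars.\<close>

lemma submodule_iff:
  "submodule H R M \<longleftrightarrow> H \<subseteq> carrier M \<and> \<zero>\<^bsub>M\<^esub> \<in> H \<and>
     (\<forall>x\<in>H. \<forall>y\<in>H. x \<oplus>\<^bsub>M\<^esub> y \<in> H) \<and> (\<forall>r\<in>carrier R. \<forall>x\<in>H. r \<odot>\<^bsub>M\<^esub> x \<in> H)"
    (is "_ \<longleftrightarrow> ?r")
proof
  assume "submodule H R M"
  then interpret H: submodule H R M .
  show ?r using H.subset H.one_closed H.m_closed H.smult_closed by auto
next
  assume r: ?r
  have "\<ominus>\<^bsub>M\<^esub> x \<in> H" if "x \<in> H" for x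
  proof -
    have "(\<ominus>\<^bsub>R\<^esub> \<one>\<^bsub>R\<^esub>) \<odot>\<^bsub>M\<^esub> x \<in> H" using r that by simp
    moreover have "x \<in> carrier M" using r that by blast
    ultimately show ?thesis using smult_minus_one by metis
  qed
  then show "submodule H R M"
    using r by (intro submodule.intro subgroup.intro submodule_axioms.intro)
      (auto simp: a_inv_def)
qed

lemma submoduleI:
  assumes "H \<subseteq> carrier M" "\<zero>\<^bsub>M\<^esub> \<in> H" "\<And>x y. \<lbrakk>x \<in> H; y \<in> H\<rbrakk> \<Longrightarrow> x \<oplus>\<^bsub>M\<^esub> y \<in> H"
    "\<And>r x. \<lbrakk>r \<in> carrier R; x \<in> H\<rbrakk> \<Longrightarrow> r \<odot>\<^bsub>M\<^esub> x \<in> H"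
  shows "submodule H R M"
  using assms by (simp add: submodule_iff)

lemma submodule_neg:
  assumes "submodule H R M" "x \<in> H"
  shows "\<ominus>\<^bsub>M\<^esub> x \<in> H"
proof -
  have H: "H \<subseteq> carrier M" "\<forall>r\<in>carrier R. \<forall>x\<in>H. r \<odot>\<^bsub>M\<^esub> x \<in> H"
    using assms(1) by (auto simp: submodule_iff)
  have "(\<ominus>\<^bsub>R\<^esub> \<one>\<^bsub>R\<^esub>) \<odot>\<^bsub>M\<^esub> x \<in> H" using H(2) assms(2) by simp
  moreover have "x \<in> carrier M" using H assms(2) by blast
  ultimately show ?thesis using smult_minus_one by metis
qed

lemma submodule_minus: "submodule H R M \<Longrightarrow> x \<in> H \<Longrightarrow> y \<in> H \<Longrightarrow> x \<ominus>\<^bsub>M\<^esub> y \<in> H"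
  by (simp add: a_minus_def submodule_iff submodule_neg)

lemma submodule_carrier: "submodule (carrier M) R M"
  by (simp add: submodule_iff)

lemma submodule_zero: "submodule {\<zero>\<^bsub>M\<^esub>} R M"
  by (simp add: submodule_iff)

lemma submodule_Int: "submodule H R M \<Longrightarrow> submodule K R M \<Longrightarrow> submodule (H \<inter> K) R M"
  by (auto simp: submodule_iff)

lemma lmod_map_zero:
  assumes "lmod_map R M C f" "left_module R C"
  shows "f \<zero>\<^bsub>M\<^esub> = \<zero>\<^bsub>C\<^esub>"
proof -
  interpret C: left_module R C by fact
  show ?thesis using lmod_mapD[OF assms(1)]
    by (metis C.smult_l_null M.zero_closed R.zero_closed smult_l_null)
qed

lemma lmod_map_neg:
  assumes "lmod_map R M C f" "left_module R C" "x \<in> carrier M"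
  shows "f (\<ominus>\<^bsub>M\<^esub> x) = \<ominus>\<^bsub>C\<^esub> f x"
proof -
  interpret C: left_module R C by fact
  show ?thesis using lmod_mapD[OF assms(1)] assms(3)
    by (metis C.smult_minus_one R.a_inv_closed R.one_closed smult_minus_one)
qed

lemma lmod_map_minus:
  assumes "lmod_map R M C f" "left_module R C" "x \<in> carrier M" "y \<in> carrier M"
  shows "f (x \<ominus>\<^bsub>M\<^esub> y) = f x \<ominus>\<^bsub>C\<^esub> f y"
  using assms by (simp add: a_minus_def lmod_map_neg lmod_mapD(2))

lemma minus_eq_zero_iff:
  assumes "x \<in> carrier M" "y \<in> carrier M"
  shows "x \<ominus>\<^bsub>M\<^esub> y = \<zero>\<^bsub>M\<^esub> \<longleftrightarrow> x = y"
  using assms by (metis M.a_inv_closed M.minus_equality M.minus_minus M.r_neg M.minus_eq)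

lemma lmod_map_eq_iff:
  assumes "lmod_map R M C f" "left_module R C" "x \<in> carrier M" "y \<in> carrier M"
  shows "f x = f y \<longleftrightarrow> f (x \<ominus>\<^bsub>M\<^esub> y) = \<zero>\<^bsub>C\<^esub>"
proof -
  interpret C: left_module R C by fact
  show ?thesis using assms by (simp add: lmod_map_minus lmod_mapD(1) C.minus_eq_zero_iff)
qed

lemma lmod_hom_restrict:
  assumes "lmod_map R M C f"
  shows "restrict f (carrier M) \<in> lmod_hom R M C"
  using assms unfolding lmod_map_def lmod_hom_def by auto

lemma submodule_kernel:
  assumes "lmod_map R M C f" "left_module R C"
  shows "submodule {x \<in> carrier M. f x = \<zero>\<^bsub>C\<^esub>} R M"
proof -
  interpret C: left_module R C by fact
  show ?thesis using lmod_map_zero[OF assms] lmod_mapD[OF assms(1)]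
    by (intro submoduleI) auto
qed

lemma submodule_vimage:
  assumes "lmod_map R M C f" "left_module R C" "submodule L R C"
  shows "submodule {x \<in> carrier M. f x \<in> L} R M"
proof -
  interpret C: left_module R C by fact
  show ?thesis using lmod_map_zero[OF assms(1,2)] lmod_mapD[OF assms(1)] assms(3)
    by (intro submoduleI) (auto simp: C.submodule_iff)
qed

lemma submodule_image:
  assumes "lmod_map R M C f" "left_module R C"
  shows "submodule (f ` carrier M) R C"
proof -
  interpret C: left_module R C by fact
  note D = lmod_mapD[OF assms(1)]
  show ?thesis
  proof (rule C.submoduleI)
    show "\<zero>\<^bsub>C\<^esub> \<in> f ` carrier M" using lmod_map_zero[OF assms] by (metis M.zero_closed image_eqI)
  next
    fix x y assume "x \<in> f ` carrier M" "y \<in> f ` carrier M"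
    then obtain u v where "u \<in> carrier M" "x = f u" "v \<in> carrier M" "y = f v" by blast
    then show "x \<oplus>\<^bsub>C\<^esub> y \<in> f ` carrier M" using D(2)[of u v] by (metis M.a_closed image_eqI)
  next
    fix r x assume "r \<in> carrier R" "x \<in> f ` carrier M"
    then obtain u where "r \<in> carrier R" "u \<in> carrier M" "x = f u" by blast
    then show "r \<odot>\<^bsub>C\<^esub> x \<in> f ` carrier M" using D(3)[of r u] by (metis smult_closed image_eqI)
  qed (use D(1) in auto)
qed

lemma left_module_sub:
  assumes "submodule B R M"
  shows "left_module R (M\<lparr>carrier := B\<rparr>)"
proof -
  note B = assms[unfolded submodule_iff]
  have c: "x \<in> carrier M" if "x \<in> B" for x using B that by auto
  show ?thesis
  proof (rule left_moduleI)
    show "ring R" by (rule R.ring_axioms)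
    show "abelian_group (M\<lparr>carrier := B\<rparr>)"
    proof (rule abelian_groupI)
      fix x assume "x \<in> carrier (M\<lparr>carrier := B\<rparr>)"
      then have x: "x \<in> B" by simp
      show "\<exists>y\<in>carrier (M\<lparr>carrier := B\<rparr>). y \<oplus>\<^bsub>M\<lparr>carrier := B\<rparr>\<^esub> x = \<zero>\<^bsub>M\<lparr>carrier := B\<rparr>\<^esub>"
        using submodule_neg[OF assms x] M.l_neg[OF c[OF x]] by auto
    next
      fix x y z assume "x \<in> carrier (M\<lparr>carrier := B\<rparr>)" "y \<in> carrier (M\<lparr>carrier := B\<rparr>)"
        "z \<in> carrier (M\<lparr>carrier := B\<rparr>)"
      then show "x \<oplus>\<^bsub>M\<lparr>carrier := B\<rparr>\<^esub> y \<oplus>\<^bsub>M\<lparr>carrier := B\<rparr>\<^esub> z =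
          x \<oplus>\<^bsub>M\<lparr>carrier := B\<rparr>\<^esub> (y \<oplus>\<^bsub>M\<lparr>carrier := B\<rparr>\<^esub> z)"
        using c by (simp add: M.a_assoc)
    next
      fix x y assume "x \<in> carrier (M\<lparr>carrier := B\<rparr>)" "y \<in> carrier (M\<lparr>carrier := B\<rparr>)"
      then show "x \<oplus>\<^bsub>M\<lparr>carrier := B\<rparr>\<^esub> y = y \<oplus>\<^bsub>M\<lparr>carrier := B\<rparr>\<^esub> x"
        using c by (simp add: M.a_comm)
    qed (use B c in auto)
  qed (use B c in \<open>auto simp: smult_l_distr smult_r_distr smult_assoc1\<close>)
qed

lemma submodule_sub_iff:
  assumes "submodule B R M"
  shows "submodule L R (M\<lparr>carrier := B\<rparr>) \<longleftrightarrow> submodule L R M \<and> L \<subseteq> B"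
proof -
  interpret B: left_module R "M\<lparr>carrier := B\<rparr>" by (rule left_module_sub[OF assms])
  show ?thesis using assms by (auto simp: submodule_iff B.submodule_iff)
qed

text \<open>The difference is formed in \<open>M\<close>, although \<open>f\<close> is linear only
  on \<open>B\<close>. Applying \<open>f\<close> to x = (x - y) + y avoids comparing additive
  inverses in the restricted record with those in \<open>M\<close>.\<close>

lemma lmod_map_sub_eq_iff:
  assumes B: "submodule B R M" and f: "lmod_map R (M\<lparr>carrier := B\<rparr>) C f" "left_module R C"
    and x: "x \<in> B" and y: "y \<in> B"
  shows "f x = f y \<longleftrightarrow> f (x \<ominus>\<^bsub>M\<^esub> y) = \<zero>\<^bsub>C\<^esub>"
proof -
  interpret C: left_module R C by fact
  have d: "x \<ominus>\<^bsub>M\<^esub> y \<in> B" by (rule submodule_minus[OF B x y])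
  have c: "x \<in> carrier M" "y \<in> carrier M" using B x y by (auto simp: submodule_iff)
  have "x = (x \<ominus>\<^bsub>M\<^esub> y) \<oplus>\<^bsub>M\<^esub> y" using c by (simp add: a_minus_def M.a_assoc M.l_neg)
  then have "f x = f (x \<ominus>\<^bsub>M\<^esub> y) \<oplus>\<^bsub>C\<^esub> f y"
    using lmod_mapD(2)[OF f(1), of "x \<ominus>\<^bsub>M\<^esub> y" y] d y by simp
  then show ?thesis
    using lmod_mapD(1)[OF f(1), of y] lmod_mapD(1)[OF f(1), of "x \<ominus>\<^bsub>M\<^esub> y"] d y
    by simp
qed

lemma submodule_image_sub:
  assumes "submodule B R M" "lmod_map R (M\<lparr>carrier := B\<rparr>) C f" "left_module R C"
  shows "submodule (f ` B) R C"
  using left_module.submodule_image[OF left_module_sub[OF assms(1)] assms(2,3)] by simp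

text \<open>The module axioms are equations, so they pass to the image of a surjection respecting
  the operations; an inverse of q x is q (-x). Factor modules and their copies obtain their axioms
  this way.\<close>

lemma left_module_surj_image:
  assumes "q ` carrier M = carrier C"
    and add: "\<And>x y. \<lbrakk>x \<in> carrier M; y \<in> carrier M\<rbrakk> \<Longrightarrow> q (x \<oplus>\<^bsub>M\<^esub> y) = q x \<oplus>\<^bsub>C\<^esub> q y"
    and sm: "\<And>r x. \<lbrakk>r \<in> carrier R; x \<in> carrier M\<rbrakk> \<Longrightarrow> q (r \<odot>\<^bsub>M\<^esub> x) = r \<odot>\<^bsub>C\<^esub> q x"
    and z: "q \<zero>\<^bsub>M\<^esub> = \<zero>\<^bsub>C\<^esub>"
  shows "left_module R C"
proof -
  have cl: "\<And>x. x \<in> carrier M \<Longrightarrow> q x \<in> carrier C" using assms(1) by auto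
  have ex: "\<And>c. c \<in> carrier C \<Longrightarrow> \<exists>x\<in>carrier M. c = q x" using assms(1) by auto
  show ?thesis
  proof (rule left_moduleI)
    show "ring R" by (rule R.ring_axioms)
    show "abelian_group C"
    proof (rule abelian_groupI)
      show "\<zero>\<^bsub>C\<^esub> \<in> carrier C" using cl[of "\<zero>\<^bsub>M\<^esub>"] z by simp
    next
      fix a b assume "a \<in> carrier C" "b \<in> carrier C"
      then show "a \<oplus>\<^bsub>C\<^esub> b \<in> carrier C" "a \<oplus>\<^bsub>C\<^esub> b = b \<oplus>\<^bsub>C\<^esub> a"
        by (metis ex cl add M.a_closed M.a_comm)+
    next
      fix a b c assume "a \<in> carrier C" "b \<in> carrier C" "c \<in> carrier C"
      then obtain x y z where "x \<in> carrier M" "a = q x" "y \<in> carrier M" "b = q y" "z \<in> carrier M" "c = q z"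
        using ex by metis
      then show "a \<oplus>\<^bsub>C\<^esub> b \<oplus>\<^bsub>C\<^esub> c = a \<oplus>\<^bsub>C\<^esub> (b \<oplus>\<^bsub>C\<^esub> c)"
        by (simp add: add[symmetric] M.a_assoc)
    next
      fix a assume "a \<in> carrier C"
      then obtain x where x: "x \<in> carrier M" "a = q x" using ex by metis
      then show "\<zero>\<^bsub>C\<^esub> \<oplus>\<^bsub>C\<^esub> a = a" by (simp add: z[symmetric] add[symmetric])
      show "\<exists>y\<in>carrier C. y \<oplus>\<^bsub>C\<^esub> a = \<zero>\<^bsub>C\<^esub>"
        using x by (intro bexI[of _ "q (\<ominus>\<^bsub>M\<^esub> x)"]) (simp_all add: add[symmetric] M.l_neg z cl)
    qed
  next
    fix a b x assume *: "a \<in> carrier R" "b \<in> carrier R" "x \<in> carrier C"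
    then obtain u where "u \<in> carrier M" "x = q u" using ex by metis
    with * show "(a \<oplus>\<^bsub>R\<^esub> b) \<odot>\<^bsub>C\<^esub> x = a \<odot>\<^bsub>C\<^esub> x \<oplus>\<^bsub>C\<^esub> b \<odot>\<^bsub>C\<^esub> x"
        "(a \<otimes>\<^bsub>R\<^esub> b) \<odot>\<^bsub>C\<^esub> x = a \<odot>\<^bsub>C\<^esub> (b \<odot>\<^bsub>C\<^esub> x)"
      by (simp_all add: sm[symmetric] add[symmetric] smult_l_distr smult_assoc1)
  next
    fix a x y assume *: "a \<in> carrier R" "x \<in> carrier C" "y \<in> carrier C"
    then obtain u v where "u \<in> carrier M" "x = q u" "v \<in> carrier M" "y = q v" using ex by metis
    with * show "a \<odot>\<^bsub>C\<^esub> (x \<oplus>\<^bsub>C\<^esub> y) = a \<odot>\<^bsub>C\<^esub> x \<oplus>\<^bsub>C\<^esub> a \<odot>\<^bsub>C\<^esub> y"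
      by (simp add: sm[symmetric] add[symmetric] smult_r_distr)
  next
    fix a x assume *: "a \<in> carrier R" "x \<in> carrier C"
    then show "a \<odot>\<^bsub>C\<^esub> x \<in> carrier C" by (metis ex cl sm smult_closed)
  next
    fix x assume *: "x \<in> carrier C"
    then show "\<one>\<^bsub>R\<^esub> \<odot>\<^bsub>C\<^esub> x = x" by (metis R.one_closed ex sm smult_one)
  qed
qed

section \<open>Cosets and the factor module\<close>

lemma coset_memI: "submodule N R M \<Longrightarrow> x \<in> carrier M \<Longrightarrow> x \<in> N +>\<^bsub>M\<^esub> x"
  by (auto simp: a_r_coset_def' submodule_iff intro!: bexI[of _ "\<zero>\<^bsub>M\<^esub>"])

lemma coset_mem_iff:
  assumes N: "submodule N R M" and x: "x \<in> carrier M"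
  shows "y \<in> N +>\<^bsub>M\<^esub> x \<longleftrightarrow> y \<in> carrier M \<and> y \<ominus>\<^bsub>M\<^esub> x \<in> N"
proof
  assume "y \<in> N +>\<^bsub>M\<^esub> x"
  then obtain n where n: "n \<in> N" "y = n \<oplus>\<^bsub>M\<^esub> x" by (auto simp: a_r_coset_def')
  have nc: "n \<in> carrier M" using n N by (auto simp: submodule_iff)
  then have "y \<ominus>\<^bsub>M\<^esub> x = n" using n x by (simp add: a_minus_def M.a_assoc M.r_neg)
  then show "y \<in> carrier M \<and> y \<ominus>\<^bsub>M\<^esub> x \<in> N" using n nc x by simp
next
  assume "y \<in> carrier M \<and> y \<ominus>\<^bsub>M\<^esub> x \<in> N"
  moreover from this have "y = (y \<ominus>\<^bsub>M\<^esub> x) \<oplus>\<^bsub>M\<^esub> x"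
    using x by (simp add: a_minus_def M.a_assoc M.l_neg)
  ultimately show "y \<in> N +>\<^bsub>M\<^esub> x" unfolding a_r_coset_def' by blast
qed

lemma coset_eq_iff:
  assumes N: "submodule N R M" and x: "x \<in> carrier M" and y: "y \<in> carrier M"
  shows "N +>\<^bsub>M\<^esub> y = N +>\<^bsub>M\<^esub> x \<longleftrightarrow> y \<ominus>\<^bsub>M\<^esub> x \<in> N"
proof
  assume "N +>\<^bsub>M\<^esub> y = N +>\<^bsub>M\<^esub> x"
  then show "y \<ominus>\<^bsub>M\<^esub> x \<in> N" using coset_memI[OF N y] coset_mem_iff[OF N x] by simp
next
  assume d: "y \<ominus>\<^bsub>M\<^esub> x \<in> N"
  have d': "x \<ominus>\<^bsub>M\<^esub> y \<in> N" using submodule_neg[OF N d] x y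
    by (simp add: a_minus_def M.minus_add M.a_comm)
  have tr: "a \<ominus>\<^bsub>M\<^esub> c \<in> N" if "a \<ominus>\<^bsub>M\<^esub> b \<in> N" "b \<ominus>\<^bsub>M\<^esub> c \<in> N" "a \<in> carrier M" "b \<in> carrier M" "c \<in> carrier M" for a b c
  proof -
    have "a \<ominus>\<^bsub>M\<^esub> c = (a \<ominus>\<^bsub>M\<^esub> b) \<oplus>\<^bsub>M\<^esub> (b \<ominus>\<^bsub>M\<^esub> c)" using that(3-5)
      by (simp add: a_minus_def M.a_assoc M.r_neg1)
    then show ?thesis using N that by (simp add: submodule_iff)
  qed
  show "N +>\<^bsub>M\<^esub> y = N +>\<^bsub>M\<^esub> x"
    using tr[OF _ d] tr[OF _ d'] x y by (auto simp: coset_mem_iff[OF N])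
qed

lemma coset_eq_self_iff:
  assumes N: "submodule N R M" and x: "x \<in> carrier M"
  shows "N +>\<^bsub>M\<^esub> x = N \<longleftrightarrow> x \<in> N"
proof -
  have "N +>\<^bsub>M\<^esub> \<zero>\<^bsub>M\<^esub> = N" using N by (auto simp: coset_mem_iff submodule_iff a_minus_def)
  moreover have "x \<ominus>\<^bsub>M\<^esub> \<zero>\<^bsub>M\<^esub> = x" using x by (simp add: M.minus_eq)
  ultimately show ?thesis using coset_eq_iff[OF N M.zero_closed x] by simp
qed

lemma quot_carrier: "carrier (quot_module M N) = (\<lambda>x. N +>\<^bsub>M\<^esub> x) ` carrier M"
  by (auto simp: quot_module_def A_RCOSETS_def')

lemma quot_zero [simp]: "\<zero>\<^bsub>quot_module M N\<^esub> = N"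
  by (simp add: quot_module_def)

lemma quot_add:
  assumes N: "submodule N R M" and x: "x \<in> carrier M" and y: "y \<in> carrier M"
  shows "(N +>\<^bsub>M\<^esub> x) \<oplus>\<^bsub>quot_module M N\<^esub> (N +>\<^bsub>M\<^esub> y) = N +>\<^bsub>M\<^esub> (x \<oplus>\<^bsub>M\<^esub> y)"
proof -
  have "additive_subgroup N M" using N by (auto intro!: additive_subgroup.intro simp: submodule_def)
  then interpret N: abelian_subgroup N M
    using M.abelian_group_axioms by (intro abelian_subgroupI3)
  show ?thesis using N.a_rcos_sum[OF x y] by (simp add: quot_module_def)
qed

text \<open>The product in \<open>quot_module\<close> is a union over all representatives y of a
  coset. The cosets in it coincide, because r y - r x = r (y - x) lies in \<open>N\<close>.\<close>

lemma quot_smult: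
  assumes N: "submodule N R M" and x: "x \<in> carrier M" and r: "r \<in> carrier R"
  shows "r \<odot>\<^bsub>quot_module M N\<^esub> (N +>\<^bsub>M\<^esub> x) = N +>\<^bsub>M\<^esub> (r \<odot>\<^bsub>M\<^esub> x)"
proof -
  have "N +>\<^bsub>M\<^esub> (r \<odot>\<^bsub>M\<^esub> y) = N +>\<^bsub>M\<^esub> (r \<odot>\<^bsub>M\<^esub> x)" if y: "y \<in> N +>\<^bsub>M\<^esub> x" for y
  proof -
    from y have y: "y \<in> carrier M" "y \<ominus>\<^bsub>M\<^esub> x \<in> N" using coset_mem_iff[OF N x] by auto
    have "r \<odot>\<^bsub>M\<^esub> \<ominus>\<^bsub>M\<^esub> x = \<ominus>\<^bsub>M\<^esub> (r \<odot>\<^bsub>M\<^esub> x)"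
      using r x by (metis M.a_inv_closed M.add.inv_equality M.l_neg smult_closed smult_r_distr smult_r_null)
    then have "r \<odot>\<^bsub>M\<^esub> y \<ominus>\<^bsub>M\<^esub> r \<odot>\<^bsub>M\<^esub> x = r \<odot>\<^bsub>M\<^esub> (y \<ominus>\<^bsub>M\<^esub> x)"
      using r x y by (simp add: a_minus_def smult_r_distr)
    then show ?thesis using y r N x by (simp add: coset_eq_iff submodule_iff)
  qed
  then have "(\<Union>y\<in>N +>\<^bsub>M\<^esub> x. N +>\<^bsub>M\<^esub> (r \<odot>\<^bsub>M\<^esub> y)) = (\<Union>y\<in>N +>\<^bsub>M\<^esub> x. N +>\<^bsub>M\<^esub> (r \<odot>\<^bsub>M\<^esub> x))"
    by (intro SUP_cong refl)
  also have "\<dots> = N +>\<^bsub>M\<^esub> (r \<odot>\<^bsub>M\<^esub> x)" using coset_memI[OF N x] by (intro SUP_const) blast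
  finally have "(\<Union>y\<in>N +>\<^bsub>M\<^esub> x. N +>\<^bsub>M\<^esub> (r \<odot>\<^bsub>M\<^esub> y)) = N +>\<^bsub>M\<^esub> (r \<odot>\<^bsub>M\<^esub> x)" .
  then show ?thesis by (simp add: quot_module_def)
qed

lemma left_module_quot:
  assumes "submodule N R M"
  shows "left_module R (quot_module M N)"
proof (rule left_module_surj_image)
  show "(\<lambda>x. N +>\<^bsub>M\<^esub> x) ` carrier M = carrier (quot_module M N)" by (simp add: quot_carrier)
  show "N +>\<^bsub>M\<^esub> \<zero>\<^bsub>M\<^esub> = \<zero>\<^bsub>quot_module M N\<^esub>"
    using assms by (simp add: coset_eq_self_iff submodule_iff)
qed (simp_all add: assms quot_add quot_smult)

lemma lmod_map_quot:
  "submodule N R M \<Longrightarrow> lmod_map R M (quot_module M N) (\<lambda>x. N +>\<^bsub>M\<^esub> x)"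
  by (auto intro!: lmod_mapI simp: quot_add quot_smult quot_carrier)

end

section \<open>Subquotients in \<open>\<sigma>[M]\<close> and lifting\<close>

context left_module
begin

lemma copower_sel [simp]:
  "carrier (copower_module M I) = {x \<in> I \<rightarrow>\<^sub>E carrier M. finite {i \<in> I. x i \<noteq> \<zero>\<^bsub>M\<^esub>}}"
  "\<zero>\<^bsub>copower_module M I\<^esub> = (\<lambda>i\<in>I. \<zero>\<^bsub>M\<^esub>)"
  "x \<oplus>\<^bsub>copower_module M I\<^esub> y = (\<lambda>i\<in>I. x i \<oplus>\<^bsub>M\<^esub> y i)"
  "r \<odot>\<^bsub>copower_module M I\<^esub> x = (\<lambda>i\<in>I. r \<odot>\<^bsub>M\<^esub> x i)"
  by (simp_all add: copower_module_def)

lemma left_module_copower: "left_module R (copower_module M (I :: 'i set))"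
proof -
  \<comment> \<open>Everything but the finite support condition is checked pointwise. Supports of
    sums and multiples lie in the finite set S built from the supports of the arguments.\<close>
  have fin: "finite {i \<in> I. (\<lambda>i\<in>I. f i) i \<noteq> \<zero>\<^bsub>M\<^esub>}"
    if "finite S" "\<And>i. i \<in> I \<Longrightarrow> i \<notin> S \<Longrightarrow> f i = \<zero>\<^bsub>M\<^esub>" for f S
    by (rule finite_subset[OF _ that(1)]) (use that(2) in auto)
  have val: "x i \<in> carrier M" if "x \<in> carrier (copower_module M I)" "i \<in> I" for x i
    using that by auto
  have ext: "x = y" if "x \<in> extensional I" "y \<in> extensional I" "\<And>i. i \<in> I \<Longrightarrow> x i = y i" for x y :: "'i \<Rightarrow> 'b"
    using that by (rule extensionalityI)
  have E: "x \<in> extensional I" if "x \<in> carrier (copower_module M I)" for x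
    using that by (auto simp: PiE_def)
  have add: "x \<oplus>\<^bsub>copower_module M I\<^esub> y \<in> carrier (copower_module M I)"
    if xy: "x \<in> carrier (copower_module M I)" "y \<in> carrier (copower_module M I)" for x y
    using xy fin[of "{i \<in> I. x i \<noteq> \<zero>\<^bsub>M\<^esub>} \<union> {i \<in> I. y i \<noteq> \<zero>\<^bsub>M\<^esub>}" "\<lambda>i. x i \<oplus>\<^bsub>M\<^esub> y i"] by auto
  have sm: "r \<odot>\<^bsub>copower_module M I\<^esub> x \<in> carrier (copower_module M I)"
    if xr: "x \<in> carrier (copower_module M I)" "r \<in> carrier R" for r x
    using xr fin[of "{i \<in> I. x i \<noteq> \<zero>\<^bsub>M\<^esub>}" "\<lambda>i. r \<odot>\<^bsub>M\<^esub> x i"] by auto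
  have zero: "\<zero>\<^bsub>copower_module M I\<^esub> \<in> carrier (copower_module M I)"
    using fin[of "{}" "\<lambda>_. \<zero>\<^bsub>M\<^esub>"] by auto
  have sp: "\<zero>\<^bsub>copower_module M I\<^esub> i = \<zero>\<^bsub>M\<^esub>"
    "(x \<oplus>\<^bsub>copower_module M I\<^esub> y) i = x i \<oplus>\<^bsub>M\<^esub> y i"
    "(r \<odot>\<^bsub>copower_module M I\<^esub> x) i = r \<odot>\<^bsub>M\<^esub> x i" if "i \<in> I" for x y r i
    using that by simp_all
  show ?thesis
  proof (rule left_moduleI)
    show "ring R" by (rule R.ring_axioms)
    show "abelian_group (copower_module M I)"
    proof (rule abelian_groupI)
      fix x assume x: "x \<in> carrier (copower_module M I)"
      have "(\<ominus>\<^bsub>R\<^esub> \<one>\<^bsub>R\<^esub>) \<odot>\<^bsub>copower_module M I\<^esub> x \<oplus>\<^bsub>copower_module M I\<^esub> x = \<zero>\<^bsub>copower_module M I\<^esub>"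
      proof (rule ext[OF E E])
        fix i assume i: "i \<in> I"
        show "((\<ominus>\<^bsub>R\<^esub> \<one>\<^bsub>R\<^esub>) \<odot>\<^bsub>copower_module M I\<^esub> x \<oplus>\<^bsub>copower_module M I\<^esub> x) i = \<zero>\<^bsub>copower_module M I\<^esub> i"
          unfolding sp[OF i] using val[OF x i] by (simp add: smult_minus_one M.l_neg)
      qed (intro add sm x zero R.a_inv_closed R.one_closed)+
      then show "\<exists>y\<in>carrier (copower_module M I). y \<oplus>\<^bsub>copower_module M I\<^esub> x = \<zero>\<^bsub>copower_module M I\<^esub>"
        using sm[OF x R.a_inv_closed[OF R.one_closed]] by blast
      show "\<zero>\<^bsub>copower_module M I\<^esub> \<oplus>\<^bsub>copower_module M I\<^esub> x = x"
      proof (rule ext[OF E E])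
        fix i assume i: "i \<in> I"
        show "(\<zero>\<^bsub>copower_module M I\<^esub> \<oplus>\<^bsub>copower_module M I\<^esub> x) i = x i"
          unfolding sp[OF i] using val[OF x i] by simp
      qed (intro add x zero)+
    next
      fix x y assume xy: "x \<in> carrier (copower_module M I)" "y \<in> carrier (copower_module M I)"
      show "x \<oplus>\<^bsub>copower_module M I\<^esub> y = y \<oplus>\<^bsub>copower_module M I\<^esub> x"
      proof (rule ext[OF E E])
        fix i assume i: "i \<in> I"
        show "(x \<oplus>\<^bsub>copower_module M I\<^esub> y) i = (y \<oplus>\<^bsub>copower_module M I\<^esub> x) i"
          unfolding sp[OF i] using val[OF _ i] xy by (simp only: M.a_comm)
      qed (intro add xy)+
      fix z assume z: "z \<in> carrier (copower_module M I)"
      show "x \<oplus>\<^bsub>copower_module M I\<^esub> y \<oplus>\<^bsub>copower_module M I\<^esub> z =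
          x \<oplus>\<^bsub>copower_module M I\<^esub> (y \<oplus>\<^bsub>copower_module M I\<^esub> z)"
      proof (rule ext[OF E E])
        fix i assume i: "i \<in> I"
        show "(x \<oplus>\<^bsub>copower_module M I\<^esub> y \<oplus>\<^bsub>copower_module M I\<^esub> z) i =
          (x \<oplus>\<^bsub>copower_module M I\<^esub> (y \<oplus>\<^bsub>copower_module M I\<^esub> z)) i"
          unfolding sp[OF i] using val[OF _ i] xy z by (simp only: M.a_assoc)
      qed (intro add xy z)+
    qed (erule (1) add, rule zero)
  next
    fix a b x assume *: "a \<in> carrier R" "b \<in> carrier R" "x \<in> carrier (copower_module M I)"
    show "(a \<oplus>\<^bsub>R\<^esub> b) \<odot>\<^bsub>copower_module M I\<^esub> x =
       a \<odot>\<^bsub>copower_module M I\<^esub> x \<oplus>\<^bsub>copower_module M I\<^esub> b \<odot>\<^bsub>copower_module M I\<^esub> x"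
    proof (rule ext[OF E E])
      fix i assume i: "i \<in> I"
      show "((a \<oplus>\<^bsub>R\<^esub> b) \<odot>\<^bsub>copower_module M I\<^esub> x) i =
       (a \<odot>\<^bsub>copower_module M I\<^esub> x \<oplus>\<^bsub>copower_module M I\<^esub> b \<odot>\<^bsub>copower_module M I\<^esub> x) i"
        unfolding sp[OF i] using val[OF _ i] * by (simp only: smult_l_distr)
    qed (intro add sm R.a_closed *)+
    show "(a \<otimes>\<^bsub>R\<^esub> b) \<odot>\<^bsub>copower_module M I\<^esub> x =
       a \<odot>\<^bsub>copower_module M I\<^esub> (b \<odot>\<^bsub>copower_module M I\<^esub> x)"
    proof (rule ext[OF E E])
      fix i assume i: "i \<in> I"
      show "((a \<otimes>\<^bsub>R\<^esub> b) \<odot>\<^bsub>copower_module M I\<^esub> x) i =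
       (a \<odot>\<^bsub>copower_module M I\<^esub> (b \<odot>\<^bsub>copower_module M I\<^esub> x)) i"
        unfolding sp[OF i] using val[OF _ i] * by (simp only: smult_assoc1)
    qed (intro add sm R.m_closed *)+
  next
    fix a x y assume *: "a \<in> carrier R" "x \<in> carrier (copower_module M I)" "y \<in> carrier (copower_module M I)"
    show "a \<odot>\<^bsub>copower_module M I\<^esub> (x \<oplus>\<^bsub>copower_module M I\<^esub> y) =
       a \<odot>\<^bsub>copower_module M I\<^esub> x \<oplus>\<^bsub>copower_module M I\<^esub> a \<odot>\<^bsub>copower_module M I\<^esub> y"
    proof (rule ext[OF E E])
      fix i assume i: "i \<in> I"
      show "(a \<odot>\<^bsub>copower_module M I\<^esub> (x \<oplus>\<^bsub>copower_module M I\<^esub> y)) i =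
       (a \<odot>\<^bsub>copower_module M I\<^esub> x \<oplus>\<^bsub>copower_module M I\<^esub> a \<odot>\<^bsub>copower_module M I\<^esub> y) i"
        unfolding sp[OF i] using val[OF _ i] * by (simp only: smult_r_distr)
    qed (intro add sm *)+
  next
    fix x assume *: "x \<in> carrier (copower_module M I)"
    show "\<one>\<^bsub>R\<^esub> \<odot>\<^bsub>copower_module M I\<^esub> x = x"
    proof (rule ext[OF E E])
      fix i assume i: "i \<in> I"
      show "(\<one>\<^bsub>R\<^esub> \<odot>\<^bsub>copower_module M I\<^esub> x) i = x i"
        unfolding sp[OF i] using val[OF _ i] * by (simp only: smult_one)
    qed (intro sm R.one_closed *)+
  qed (rule sm)
qed

text \<open>With K the kernel of \<open>q\<close>, the module \<open>A\<close> is a copy of B/K,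
  which is a submodule of M/K, a quotient of a single copy of \<open>M\<close>.\<close>

lemma in_sigmaI:
  fixes A :: "('a, 'c, 'n) module_scheme"
  assumes B: "submodule B R M" and A: "left_module R A"
    and q: "lmod_map R (M\<lparr>carrier := B\<rparr>) A q" "q ` B = carrier A"
  shows "in_sigma R M A"
proof -
  \<comment> \<open>A one-element index set makes the copower a copy of \<open>M\<close> through
    \<open>e\<close>; the index itself is arbitrary.\<close>
  define I :: "(nat \<times> 'c) set" where "I = {(0, undefined)}"
  define j :: "nat \<times> 'c" where "j = (0, undefined)"
  define P where "P = copower_module M I"
  have I: "I = {j}" by (simp add: I_def j_def)
  interpret A: left_module R A by fact
  interpret P: left_module R P unfolding P_def by (rule left_module_copower)
  interpret B: left_module R "M\<lparr>carrier := B\<rparr>" by (rule left_module_sub[OF B])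
  define e where "e b = (\<lambda>i\<in>I. b)" for b :: 'b
  define K where "K = e ` {b \<in> B. q b = \<zero>\<^bsub>A\<^esub>}"
  have Bc: "b \<in> carrier M" if "b \<in> B" for b using B that by (auto simp: submodule_iff)
  have e: "lmod_map R M P e"
  proof (rule lmod_mapI)
    fix x assume "x \<in> carrier M"
    have "finite {i \<in> I. e x i \<noteq> \<zero>\<^bsub>M\<^esub>}" by (simp add: I)
    with \<open>x \<in> carrier M\<close> show "e x \<in> carrier P" by (simp add: P_def e_def)
  qed (auto simp: P_def e_def fun_eq_iff)
  have e_inj: "e x = e y \<longleftrightarrow> x = y" for x y
  proof -
    have "e z j = z" for z by (simp add: e_def I)
    then show ?thesis by metis
  qed
  have ker: "submodule {b \<in> B. q b = \<zero>\<^bsub>A\<^esub>} R M"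
    using B.submodule_kernel[OF q(1) A] B submodule_sub_iff by simp
  have K: "submodule K R P"
    unfolding K_def
    by (rule submodule_image_sub[OF ker lmod_map_sub[OF e] P.left_module_axioms])
      (use Bc in auto)
  let ?Q = "quot_module P K"
  define s where "s a = (SOME b. b \<in> B \<and> q b = a)" for a
  have s: "s a \<in> B" "q (s a) = a" if "a \<in> carrier A" for a
  proof -
    have "a \<in> q ` B" using that q(2) by simp
    then have "\<exists>b. b \<in> B \<and> q b = a" by blast
    then have "s a \<in> B \<and> q (s a) = a" unfolding s_def by (rule someI_ex)
    then show "s a \<in> B" "q (s a) = a" by auto
  qed
  define h where "h a = K +>\<^bsub>P\<^esub> e (s a)" for a
  have eP: "e b \<in> carrier P" if "b \<in> B" for b using lmod_mapD(1)[OF e Bc[OF that]] .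
  \<comment> \<open>Elements of \<open>B\<close> have equal cosets exactly when they have equal
    images under \<open>q\<close>. This one equivalence gives both linearity and injectivity of
    \<open>h\<close>, despite the choice of preimages \<open>s\<close>.\<close>
  have eq: "K +>\<^bsub>P\<^esub> e b = K +>\<^bsub>P\<^esub> e b' \<longleftrightarrow> q b = q b'" if b: "b \<in> B" "b' \<in> B" for b b'
  proof -
    have bb: "b \<ominus>\<^bsub>M\<^esub> b' \<in> B" using submodule_minus[OF B] b by simp
    have "K +>\<^bsub>P\<^esub> e b = K +>\<^bsub>P\<^esub> e b' \<longleftrightarrow> e b \<ominus>\<^bsub>P\<^esub> e b' \<in> K"
      using P.coset_eq_iff[OF K] eP b by simp
    also have "e b \<ominus>\<^bsub>P\<^esub> e b' = e (b \<ominus>\<^bsub>M\<^esub> b')"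
      using lmod_map_minus[OF e P.left_module_axioms] b Bc by simp
    also have "e (b \<ominus>\<^bsub>M\<^esub> b') \<in> K \<longleftrightarrow> q (b \<ominus>\<^bsub>M\<^esub> b') = \<zero>\<^bsub>A\<^esub>"
      using bb by (auto simp: K_def e_inj)
    finally show ?thesis using lmod_map_sub_eq_iff[OF B q(1) A b] by simp
  qed
  have "lmod_map R A ?Q h"
  proof (rule lmod_mapI)
    fix x assume x: "x \<in> carrier A"
    show "h x \<in> carrier ?Q" using eP[OF s(1)[OF x]] by (auto simp: h_def P.quot_carrier)
    fix r assume r: "r \<in> carrier R"
    have "q (s (r \<odot>\<^bsub>A\<^esub> x)) = q (r \<odot>\<^bsub>M\<^esub> s x)"
      using s x r lmod_mapD(3)[OF q(1), of r "s x"] by simp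
    then have "h (r \<odot>\<^bsub>A\<^esub> x) = K +>\<^bsub>P\<^esub> e (r \<odot>\<^bsub>M\<^esub> s x)"
      unfolding h_def using eq[of "s (r \<odot>\<^bsub>A\<^esub> x)" "r \<odot>\<^bsub>M\<^esub> s x"] s(1) x r B
      by (simp add: submodule_iff)
    then show "h (r \<odot>\<^bsub>A\<^esub> x) = r \<odot>\<^bsub>?Q\<^esub> h x"
      using lmod_mapD(3)[OF e r Bc[OF s(1)[OF x]]] P.quot_smult[OF K eP[OF s(1)[OF x]] r]
      by (simp add: h_def)
  next
    fix x y assume x: "x \<in> carrier A" "y \<in> carrier A"
    have "q (s (x \<oplus>\<^bsub>A\<^esub> y)) = q (s x \<oplus>\<^bsub>M\<^esub> s y)"
      using s x lmod_mapD(2)[OF q(1), of "s x" "s y"] by simp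
    then have "h (x \<oplus>\<^bsub>A\<^esub> y) = K +>\<^bsub>P\<^esub> e (s x \<oplus>\<^bsub>M\<^esub> s y)"
      unfolding h_def using eq[of "s (x \<oplus>\<^bsub>A\<^esub> y)" "s x \<oplus>\<^bsub>M\<^esub> s y"] s(1) x B
      by (simp add: submodule_iff)
    then show "h (x \<oplus>\<^bsub>A\<^esub> y) = h x \<oplus>\<^bsub>?Q\<^esub> h y"
      using lmod_mapD(2)[OF e] P.quot_add[OF K] eP s x Bc
      by (simp add: h_def)
  qed
  then have "restrict h (carrier A) \<in> lmod_hom R A ?Q" by (rule A.lmod_hom_restrict)
  moreover have "inj_on (restrict h (carrier A)) (carrier A)"
    using eq s by (auto simp: inj_on_def h_def)
  ultimately show ?thesis unfolding in_sigma_def using A K unfolding P_def by blast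
qed

text \<open>Projectivity and co-semisimplicity quantify only over modules whose elements have type
  \<open>sigma_elem\<close>. The factor module B/K has cosets as elements; tagging their members by
  \<open>Inr\<close> and \<open>Inl\<close> gives a copy of that type, with \<open>d\<close> undoing
  the tagging \<open>e\<close>.\<close>

lemma subquotient_exists:
  assumes B: "submodule B R M" and K: "submodule K R M" "K \<subseteq> B"
  obtains C :: "('a, ('a, 'b) sigma_elem) module" and q where "left_module R C" "in_sigma R M C"
    "lmod_map R (M\<lparr>carrier := B\<rparr>) C q" "q ` B = carrier C"
    "\<forall>x\<in>B. q x = \<zero>\<^bsub>C\<^esub> \<longleftrightarrow> x \<in> K"
proof -
  let ?B = "M\<lparr>carrier := B\<rparr>"
  interpret B: left_module R ?B by (rule left_module_sub[OF B])
  have K': "submodule K R ?B" using K by (simp add: submodule_sub_iff[OF B])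
  define e :: "'b set \<Rightarrow> ('a, 'b) sigma_elem" where "e X = (\<lambda>x. Inr (Inl x)) ` X" for X
  define d :: "('a, 'b) sigma_elem \<Rightarrow> 'b set" where "d Y = {x. Inr (Inl x) \<in> Y}" for Y
  have de [simp]: "d (e X) = X" for X by (auto simp: d_def e_def)
  define Q where "Q = quot_module ?B K"
  define C :: "('a, ('a, 'b) sigma_elem) module" where "C = \<lparr>carrier = e ` carrier Q, mult = undefined, one = undefined,
     zero = e \<zero>\<^bsub>Q\<^esub>, add = (\<lambda>x y. e (d x \<oplus>\<^bsub>Q\<^esub> d y)), smult = (\<lambda>r x. e (r \<odot>\<^bsub>Q\<^esub> d x))\<rparr>"
  interpret Q: left_module R Q unfolding Q_def by (rule B.left_module_quot[OF K'])
  have C: "left_module R C"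
    by (rule Q.left_module_surj_image[where q = e]) (simp_all add: C_def)
  define q where "q x = e (K +>\<^bsub>?B\<^esub> x)" for x
  have m: "lmod_map R ?B C q"
  proof -
    have "lmod_map R Q C e" by (auto intro!: lmod_mapI simp: C_def)
    then show ?thesis unfolding q_def Q_def by (rule lmod_map_comp[OF B.lmod_map_quot[OF K']])
  qed
  have s: "q ` B = carrier C"
    using B.quot_carrier[of K] by (simp add: C_def Q_def q_def image_image)
  have z: "q x = \<zero>\<^bsub>C\<^esub> \<longleftrightarrow> x \<in> K" if "x \<in> B" for x
  proof -
    have "q x = \<zero>\<^bsub>C\<^esub> \<longleftrightarrow> K +>\<^bsub>?B\<^esub> x = K"
      by (simp add: q_def C_def Q_def) (metis de)
    then show ?thesis using B.coset_eq_self_iff[OF K'] that by simp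
  qed
  show thesis using that[OF C in_sigmaI[OF B C m s] m s] z by blast
qed

text \<open>The form in which projectivity is applied: \<open>D\<close> may live on any type, and
  \<open>p\<close> has to reach only the image of \<open>h\<close>. The image of \<open>p\<close> is
  isomorphic to B/ker p, so \<open>D\<close> is replaced by a copy \<open>C\<close> of that factor
  module.\<close>

lemma projective_lift:
  assumes proj: "projective_in_sigma R M" and B: "submodule B R M"
    and p: "lmod_map R (M\<lparr>carrier := B\<rparr>) D p" and D: "left_module R D"
    and h: "lmod_map R M D h" "h ` carrier M \<subseteq> p ` B"
  shows "\<exists>u. lmod_map R M M u \<and> u ` carrier M \<subseteq> B \<and> (\<forall>x\<in>carrier M. p (u x) = h x)"
proof -
  let ?B = "M\<lparr>carrier := B\<rparr>"
  interpret B: left_module R ?B by (rule left_module_sub[OF B])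
  have Bc: "b \<in> carrier M" if "b \<in> B" for b using B that by (auto simp: submodule_iff)
  define K where "K = {b \<in> B. p b = \<zero>\<^bsub>D\<^esub>}"
  have K: "submodule K R M" "K \<subseteq> B"
    using B.submodule_kernel[OF p D] B submodule_sub_iff by (simp_all add: K_def)
  obtain C :: "('a, ('a, 'b) sigma_elem) module" and q where C: "left_module R C" "in_sigma R M C"
    "lmod_map R ?B C q" "q ` B = carrier C" "\<forall>x\<in>B. q x = \<zero>\<^bsub>C\<^esub> \<longleftrightarrow> x \<in> K"
    by (rule subquotient_exists[OF B K])
  \<comment> \<open>\<open>B\<close> itself also needs a copy of type \<open>sigma_elem\<close>; it
    is taken as the factor module B/0.\<close>
  obtain B' :: "('a, ('a, 'b) sigma_elem) module" and b where B': "left_module R B'" "in_sigma R M B'"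
    "lmod_map R ?B B' b" "b ` B = carrier B'" "\<forall>x\<in>B. b x = \<zero>\<^bsub>B'\<^esub> \<longleftrightarrow> x \<in> {\<zero>\<^bsub>M\<^esub>}"
    by (rule subquotient_exists[OF B submodule_zero]) (use B in \<open>auto simp: submodule_iff\<close>)
  have b_eq: "b x = b y \<longleftrightarrow> x = y" if "x \<in> B" "y \<in> B" for x y
    using lmod_map_sub_eq_iff[OF B B'(3,1) that] B'(5)[rule_format, OF submodule_minus[OF B that]]
      minus_eq_zero_iff[OF Bc[OF that(1)] Bc[OF that(2)]] by simp
  \<comment> \<open>\<open>q\<close> and \<open>p\<close> have the same kernel \<open>K\<close>,
    hence the same fibres, so equations between values translate from \<open>D\<close> to
    \<open>C\<close> and back.\<close>
  have q_eq: "q x = q y \<longleftrightarrow> p x = p y" if "x \<in> B" "y \<in> B" for x y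
    using lmod_map_sub_eq_iff[OF B C(3,1) that] lmod_map_sub_eq_iff[OF B p D that]
      C(5)[rule_format, OF submodule_minus[OF B that]] submodule_minus[OF B that] by (simp add: K_def)
  define i where "i = inv_into B b"
  have i: "i y \<in> B" "b (i y) = y" if "y \<in> carrier B'" for y
    using that B'(4) by (auto simp: i_def inv_into_into f_inv_into_f)
  have ib: "i (b x) = x" if "x \<in> B" for x
    unfolding i_def by (rule inv_into_f_f[OF _ that]) (simp add: inj_on_def b_eq)
  have i_map: "lmod_map R B' ?B i"
  proof (rule lmod_mapI)
    fix x y assume *: "x \<in> carrier B'" "y \<in> carrier B'"
    interpret B'': left_module R B' by fact
    have "b (i (x \<oplus>\<^bsub>B'\<^esub> y)) = b (i x \<oplus>\<^bsub>M\<^esub> i y)"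
      using lmod_mapD(2)[OF B'(3), of "i x" "i y"] i * by simp
    then show "i (x \<oplus>\<^bsub>B'\<^esub> y) = i x \<oplus>\<^bsub>?B\<^esub> i y"
      using ib i * B by (simp add: submodule_iff)
  next
    fix r x assume *: "x \<in> carrier B'" "r \<in> carrier R"
    interpret B'': left_module R B' by fact
    have "b (i (r \<odot>\<^bsub>B'\<^esub> x)) = b (r \<odot>\<^bsub>M\<^esub> i x)"
      using lmod_mapD(3)[OF B'(3), of r "i x"] i * by simp
    then show "i (r \<odot>\<^bsub>B'\<^esub> x) = r \<odot>\<^bsub>?B\<^esub> i x"
      using ib i * B by (simp add: submodule_iff)
  qed (use i in simp)
  define g where "g y = q (i y)" for y
  have g: "lmod_map R B' C g" unfolding g_def by (rule lmod_map_comp[OF i_map C(3)])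
  \<comment> \<open>The kernel of \<open>g\<close> is the left term of the short exact sequence from
    \<open>A\<close> through \<open>B'\<close> to \<open>C\<close>. It is the copy of
    \<open>K\<close> under \<open>b\<close>, which puts it into the subgenerated category.\<close>
  define A where "A = B'\<lparr>carrier := {y \<in> carrier B'. g y = \<zero>\<^bsub>C\<^esub>}\<rparr>"
  have A_sub: "submodule {y \<in> carrier B'. g y = \<zero>\<^bsub>C\<^esub>} R B'"
    by (rule left_module.submodule_kernel[OF B'(1) g C(1)])
  have A: "left_module R A" unfolding A_def by (rule left_module.left_module_sub[OF B'(1) A_sub])
  have cA: "carrier A = b ` K"
  proof -
    have "x \<in> carrier A \<longleftrightarrow> x \<in> b ` K" for x
    proof
      assume "x \<in> carrier A"
      then have "x \<in> carrier B'" "q (i x) = \<zero>\<^bsub>C\<^esub>" by (auto simp: A_def g_def)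
      then show "x \<in> b ` K" using i[of x] C(5)[rule_format, of "i x"] by (metis image_eqI)
    next
      assume "x \<in> b ` K"
      then obtain k where k: "k \<in> K" "x = b k" by blast
      then have kB: "k \<in> B" using K by auto
      then have x: "x \<in> carrier B'" using k B'(4) by auto
      have "i x = k" using ib[OF kB] k by simp
      then show "x \<in> carrier A" using x C(5)[rule_format, OF kB] k by (simp add: A_def g_def)
    qed
    then show ?thesis by blast
  qed
  have A_sig: "in_sigma R M A"
  proof (rule in_sigmaI[OF K(1) A])
    have "lmod_map R (M\<lparr>carrier := K\<rparr>) B' b"
      using lmod_map_sub[OF B'(3), of K] K(2) by simp
    then show "lmod_map R (M\<lparr>carrier := K\<rparr>) A b"
      unfolding A_def by (rule lmod_map_into) (use cA in \<open>auto simp: A_def\<close>)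
    show "b ` K = carrier A" by (rule cA[symmetric])
  qed
  have g_surj: "g ` carrier B' = carrier C"
  proof -
    have "i ` carrier B' = B"
    proof
      show "B \<subseteq> i ` carrier B'"
      proof
        fix x assume x: "x \<in> B"
        then have "b x \<in> carrier B'" using B'(4) by auto
        moreover have "i (b x) = x" by (rule ib[OF x])
        ultimately show "x \<in> i ` carrier B'" by (metis image_eqI)
      qed
    qed (use i in auto)
    then show ?thesis using C(4) by (simp add: g_def image_image[symmetric])
  qed
  have "short_exact R A B' C (restrict id (carrier A)) (restrict g (carrier B'))"
    unfolding short_exact_def
  proof (intro conjI)
    show "restrict id (carrier A) \<in> lmod_hom R A B'"
      by (rule left_module.lmod_hom_restrict[OF A]) (auto simp: A_def lmod_map_def)
    show "restrict g (carrier B') \<in> lmod_hom R B' C"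
      by (rule left_module.lmod_hom_restrict[OF B'(1) g])
  qed (auto simp: A_def g_surj inj_on_def)
  then have "hom_short_exact R M A B' C (restrict id (carrier A)) (restrict g (carrier B'))"
    using proj A_sig B'(2) C(2) unfolding projective_in_sigma_def by blast
  then have sj: "compose (carrier M) (restrict g (carrier B')) ` lmod_hom R M B' = lmod_hom R M C"
    by (simp add: hom_short_exact_def)
  \<comment> \<open>A pointwise choice of preimages of \<open>h\<close> under \<open>p\<close>, in
    general not linear. Its composite with \<open>q\<close> is linear, since \<open>q\<close>
    identifies whatever \<open>p\<close> does; this composite is the map to be lifted.\<close>
  define t where "t x = inv_into B p (h x)" for x
  have t: "t x \<in> B" "p (t x) = h x" if "x \<in> carrier M" for x
    using that h(2) unfolding t_def by (meson f_inv_into_f image_subset_iff inv_into_into)+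
  have "lmod_map R M C (\<lambda>x. q (t x))"
  proof (rule lmod_mapI)
    fix x assume x: "x \<in> carrier M"
    show "q (t x) \<in> carrier C" using t(1)[OF x] C(4) by auto
    fix y assume y: "y \<in> carrier M"
    have "p (t (x \<oplus>\<^bsub>M\<^esub> y)) = p (t x \<oplus>\<^bsub>M\<^esub> t y)"
      using t x y lmod_mapD(2)[OF h(1) x y] lmod_mapD(2)[OF p, of "t x" "t y"] by simp
    then have "q (t (x \<oplus>\<^bsub>M\<^esub> y)) = q (t x \<oplus>\<^bsub>M\<^esub> t y)"
      using q_eq[of "t (x \<oplus>\<^bsub>M\<^esub> y)" "t x \<oplus>\<^bsub>M\<^esub> t y"] t(1) x y B
      by (simp add: submodule_iff)
    then show "q (t (x \<oplus>\<^bsub>M\<^esub> y)) = q (t x) \<oplus>\<^bsub>C\<^esub> q (t y)"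
      using t x y lmod_mapD(2)[OF C(3), of "t x" "t y"] by simp
  next
    fix r x assume x: "r \<in> carrier R" "x \<in> carrier M"
    have "p (t (r \<odot>\<^bsub>M\<^esub> x)) = p (r \<odot>\<^bsub>M\<^esub> t x)"
      using t x lmod_mapD(3)[OF h(1) x] lmod_mapD(3)[OF p, of r "t x"] by simp
    then have "q (t (r \<odot>\<^bsub>M\<^esub> x)) = q (r \<odot>\<^bsub>M\<^esub> t x)"
      using q_eq[of "t (r \<odot>\<^bsub>M\<^esub> x)" "r \<odot>\<^bsub>M\<^esub> t x"] t(1) x B
      by (simp add: submodule_iff)
    then show "q (t (r \<odot>\<^bsub>M\<^esub> x)) = r \<odot>\<^bsub>C\<^esub> q (t x)"
      using t x lmod_mapD(3)[OF C(3), of r "t x"] by simp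
  qed
  then have "restrict (\<lambda>x. q (t x)) (carrier M) \<in> lmod_hom R M C" by (rule lmod_hom_restrict)
  then obtain v where v: "v \<in> lmod_hom R M B'"
    "compose (carrier M) (restrict g (carrier B')) v = restrict (\<lambda>x. q (t x)) (carrier M)"
    unfolding sj[symmetric] by (metis (no_types, lifting) imageE)
  have vm: "lmod_map R M B' v" by (rule lmod_hom_map[OF v(1)])
  have gv: "g (v x) = q (t x)" if "x \<in> carrier M" for x
    using fun_cong[OF v(2), of x] that lmod_mapD(1)[OF vm that] by (simp add: compose_def)
  have "lmod_map R M ?B (\<lambda>x. i (v x))" by (rule lmod_map_comp[OF vm i_map])
  then have "lmod_map R M M (\<lambda>x. i (v x))"
    by (rule lmod_map_from_into) (use Bc in blast)
  moreover have "p (i (v x)) = h x" "i (v x) \<in> B" if "x \<in> carrier M" for x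
    using gv[OF that] q_eq[of "i (v x)" "t x"] i t[OF that] lmod_mapD(1)[OF vm that]
    by (auto simp: g_def)
  ultimately show ?thesis by (intro exI[of _ "\<lambda>x. i (v x)"]) auto
qed

end

section \<open>Separation by simple modules\<close>

context left_module
begin

section \<open>Cyclic submodules, sums of two submodules and unions of chains\<close>

abbreviation cyclic :: "'b \<Rightarrow> 'b set" where "cyclic x \<equiv> (\<lambda>r. r \<odot>\<^bsub>M\<^esub> x) ` carrier R"

lemma cyclic_self: "x \<in> carrier M \<Longrightarrow> x \<in> cyclic x"
  by (rule image_eqI[of _ _ "\<one>\<^bsub>R\<^esub>"]) simp_all

lemma submodule_cyclic: "x \<in> carrier M \<Longrightarrow> submodule (cyclic x) R M"
proof (rule submoduleI)
  assume x: "x \<in> carrier M"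
  then show "\<zero>\<^bsub>M\<^esub> \<in> cyclic x" by (intro image_eqI[of _ _ "\<zero>\<^bsub>R\<^esub>"]) simp_all
  fix a b assume "a \<in> cyclic x" "b \<in> cyclic x"
  then obtain r s where *: "r \<in> carrier R" "s \<in> carrier R" "a = r \<odot>\<^bsub>M\<^esub> x" "b = s \<odot>\<^bsub>M\<^esub> x" by blast
  then show "a \<oplus>\<^bsub>M\<^esub> b \<in> cyclic x"
    using x by (intro image_eqI[of _ _ "r \<oplus>\<^bsub>R\<^esub> s"]) (simp_all add: smult_l_distr)
next
  fix t a assume x: "x \<in> carrier M" and "t \<in> carrier R" "a \<in> cyclic x"
  then obtain r where "r \<in> carrier R" "a = r \<odot>\<^bsub>M\<^esub> x" by blast
  then show "t \<odot>\<^bsub>M\<^esub> a \<in> cyclic x"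
    using x \<open>t \<in> carrier R\<close> by (intro image_eqI[of _ _ "t \<otimes>\<^bsub>R\<^esub> r"]) (simp_all add: smult_assoc1)
qed auto

lemma cyclic_subset: "submodule L R M \<Longrightarrow> x \<in> L \<Longrightarrow> cyclic x \<subseteq> L"
  by (auto simp: submodule_iff)

lemma mem_set_add: "z \<in> A <+>\<^bsub>M\<^esub> B \<longleftrightarrow> (\<exists>a\<in>A. \<exists>b\<in>B. z = a \<oplus>\<^bsub>M\<^esub> b)"
  by (simp add: set_add_def')

lemma submodule_set_add:
  assumes A: "submodule A R M" and B: "submodule B R M"
  shows "submodule (A <+>\<^bsub>M\<^esub> B) R M"
proof (rule submoduleI)
  note A' = A[unfolded submodule_iff] and B' = B[unfolded submodule_iff]
  have c: "\<And>x. x \<in> A \<Longrightarrow> x \<in> carrier M" "\<And>x. x \<in> B \<Longrightarrow> x \<in> carrier M" using A' B' by auto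
  show "A <+>\<^bsub>M\<^esub> B \<subseteq> carrier M" using c by (auto simp: mem_set_add)
  show "\<zero>\<^bsub>M\<^esub> \<in> A <+>\<^bsub>M\<^esub> B" unfolding mem_set_add
    using A' B' by (intro bexI[of _ "\<zero>\<^bsub>M\<^esub>"]) auto
  fix x y assume "x \<in> A <+>\<^bsub>M\<^esub> B" "y \<in> A <+>\<^bsub>M\<^esub> B"
  then obtain a b a' b' where *: "a \<in> A" "b \<in> B" "a' \<in> A" "b' \<in> B" "x = a \<oplus>\<^bsub>M\<^esub> b" "y = a' \<oplus>\<^bsub>M\<^esub> b'"
    unfolding mem_set_add by blast
  have "x \<oplus>\<^bsub>M\<^esub> y = (a \<oplus>\<^bsub>M\<^esub> a') \<oplus>\<^bsub>M\<^esub> (b \<oplus>\<^bsub>M\<^esub> b')" using * c by (simp add: M.a_ac)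
  then show "x \<oplus>\<^bsub>M\<^esub> y \<in> A <+>\<^bsub>M\<^esub> B" unfolding mem_set_add using * A' B' by blast
next
  note A' = A[unfolded submodule_iff] and B' = B[unfolded submodule_iff]
  have c: "\<And>x. x \<in> A \<Longrightarrow> x \<in> carrier M" "\<And>x. x \<in> B \<Longrightarrow> x \<in> carrier M" using A' B' by auto
  fix r x assume r: "r \<in> carrier R" "x \<in> A <+>\<^bsub>M\<^esub> B"
  then obtain a b where *: "a \<in> A" "b \<in> B" "x = a \<oplus>\<^bsub>M\<^esub> b"
    unfolding mem_set_add by blast
  have "r \<odot>\<^bsub>M\<^esub> x = r \<odot>\<^bsub>M\<^esub> a \<oplus>\<^bsub>M\<^esub> r \<odot>\<^bsub>M\<^esub> b" using * c r by (simp add: smult_r_distr)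
  then show "r \<odot>\<^bsub>M\<^esub> x \<in> A <+>\<^bsub>M\<^esub> B" unfolding mem_set_add using * A' B' r by blast
qed

lemma set_add_upper1: "submodule A R M \<Longrightarrow> submodule B R M \<Longrightarrow> A \<subseteq> A <+>\<^bsub>M\<^esub> B"
proof
  fix x assume A: "submodule A R M" "submodule B R M" "x \<in> A"
  then have "x = x \<oplus>\<^bsub>M\<^esub> \<zero>\<^bsub>M\<^esub>" "\<zero>\<^bsub>M\<^esub> \<in> B" by (auto simp: submodule_iff)
  with A(3) show "x \<in> A <+>\<^bsub>M\<^esub> B" unfolding mem_set_add by blast
qed

lemma set_add_upper2: "submodule A R M \<Longrightarrow> submodule B R M \<Longrightarrow> B \<subseteq> A <+>\<^bsub>M\<^esub> B"
proof
  fix x assume A: "submodule A R M" "submodule B R M" "x \<in> B"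
  then have "x = \<zero>\<^bsub>M\<^esub> \<oplus>\<^bsub>M\<^esub> x" "\<zero>\<^bsub>M\<^esub> \<in> A" by (auto simp: submodule_iff)
  with A(3) show "x \<in> A <+>\<^bsub>M\<^esub> B" unfolding mem_set_add by blast
qed

lemma set_add_least:
  "submodule L R M \<Longrightarrow> A \<subseteq> L \<Longrightarrow> B \<subseteq> L \<Longrightarrow> A <+>\<^bsub>M\<^esub> B \<subseteq> L"
  unfolding mem_set_add submodule_iff subset_iff by blast

lemma submodule_Union_chain:
  assumes "C \<noteq> {}" "\<And>L. L \<in> C \<Longrightarrow> submodule L R M"
    and "\<And>L L'. L \<in> C \<Longrightarrow> L' \<in> C \<Longrightarrow> L \<subseteq> L' \<or> L' \<subseteq> L"
  shows "submodule (\<Union>C) R M"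
proof (rule submoduleI)
  fix x y assume "x \<in> \<Union>C" "y \<in> \<Union>C"
  then obtain L L' where "L \<in> C" "x \<in> L" "L' \<in> C" "y \<in> L'" by blast
  then obtain L'' where "L'' \<in> C" "x \<in> L''" "y \<in> L''" using assms(3) by blast
  then show "x \<oplus>\<^bsub>M\<^esub> y \<in> \<Union>C" using assms(2) submodule_iff by auto
qed (use assms(1,2) submodule_iff in fastforce)+

text \<open>Zorn's lemma applies to the submodules between P and P + Rx that avoid \<open>x\<close>.
  A submodule containing both P and \<open>x\<close> is all of P + Rx, so maximality among those
  avoiding \<open>x\<close> is maximality among proper submodules.\<close>

lemma maximal_submodule_avoiding:
  assumes P: "submodule P R M" and x: "x \<in> carrier M" "x \<notin> P"
  obtains L where "submodule L R M" "P \<subseteq> L" "L \<subseteq> P <+>\<^bsub>M\<^esub> cyclic x" "x \<notin> L"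
    "\<forall>T. submodule T R M \<longrightarrow> L \<subseteq> T \<longrightarrow> T \<subseteq> P <+>\<^bsub>M\<^esub> cyclic x \<longrightarrow> T = L \<or> T = P <+>\<^bsub>M\<^esub> cyclic x"
proof -
  let ?B = "P <+>\<^bsub>M\<^esub> cyclic x"
  note C = submodule_cyclic[OF x(1)]
  define Z where "Z = {L. submodule L R M \<and> P \<subseteq> L \<and> L \<subseteq> ?B \<and> x \<notin> L}"
  have "P \<in> Z" using P x set_add_upper1[OF P C] by (simp add: Z_def)
  have "\<exists>L\<in>Z. \<forall>T\<in>Z. L \<subseteq> T \<longrightarrow> T = L"
  proof (rule subset_Zorn_nonempty)
    show "Z \<noteq> {}" using \<open>P \<in> Z\<close> by blast
    fix \<C> assume ne: "\<C> \<noteq> {}" and ch: "subset.chain Z \<C>"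
    have "submodule (\<Union>\<C>) R M"
      by (rule submodule_Union_chain[OF ne]) (use ch in \<open>auto simp: subset_chain_def Z_def\<close>)
    then show "\<Union>\<C> \<in> Z" using ne ch by (auto simp: subset_chain_def Z_def subset_iff)
  qed
  then obtain L where L: "L \<in> Z" "\<And>T. T \<in> Z \<Longrightarrow> L \<subseteq> T \<Longrightarrow> T = L" by blast
  have "T = L \<or> T = ?B" if T: "submodule T R M" "L \<subseteq> T" "T \<subseteq> ?B" for T
  proof (cases "x \<in> T")
    case True
    then have "?B \<subseteq> T" using cyclic_subset[OF T(1)] L(1) T by (intro set_add_least) (auto simp: Z_def)
    then show ?thesis using T by blast
  next
    case False
    then have "T \<in> Z" using T L(1) by (auto simp: Z_def)
    then show ?thesis using L(2) T by blast
  qed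
  then show thesis using that[of L] L(1) by (auto simp: Z_def)
qed

text \<open>\<open>S\<close> is a copy of the simple module (P + Rx)/L for a maximal submodule L
  from the previous lemma, \<open>q\<close> is the projection onto it, and \<open>g\<close> extends
  \<open>q\<close> to \<open>M\<close> by injectivity of \<open>S\<close>.\<close>

lemma co_semisimple_separation:
  assumes cs: "co_semisimple R M" and P: "submodule P R M" and x: "x \<in> carrier M" "x \<notin> P"
  obtains S :: "('a, ('a, 'b) sigma_elem) module" and g q where
    "left_module R S" "relatively_injective R M S" "lmod_map R M S g"
    "lmod_map R (M\<lparr>carrier := P <+>\<^bsub>M\<^esub> cyclic x\<rparr>) S q" "q ` (P <+>\<^bsub>M\<^esub> cyclic x) = carrier S"
    "\<forall>y\<in>P <+>\<^bsub>M\<^esub> cyclic x. g y = q y" "\<forall>y\<in>P. g y = \<zero>\<^bsub>S\<^esub>" "g x \<noteq> \<zero>\<^bsub>S\<^esub>"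
proof -
  let ?B = "P <+>\<^bsub>M\<^esub> cyclic x"
  note C = submodule_cyclic[OF x(1)]
  have B: "submodule ?B R M" by (rule submodule_set_add[OF P C])
  have xB: "x \<in> ?B" using set_add_upper2[OF P C] cyclic_self[OF x(1)] by blast
  have PB: "P \<subseteq> ?B" by (rule set_add_upper1[OF P C])
  obtain L where L: "submodule L R M" "P \<subseteq> L" "L \<subseteq> ?B" "x \<notin> L"
    "\<forall>T. submodule T R M \<longrightarrow> L \<subseteq> T \<longrightarrow> T \<subseteq> ?B \<longrightarrow> T = L \<or> T = ?B"
    by (rule maximal_submodule_avoiding[OF P x])
  obtain S :: "('a, ('a, 'b) sigma_elem) module" and q where S: "left_module R S" "in_sigma R M S"
    "lmod_map R (M\<lparr>carrier := ?B\<rparr>) S q" "q ` ?B = carrier S" "\<forall>y\<in>?B. q y = \<zero>\<^bsub>S\<^esub> \<longleftrightarrow> y \<in> L"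
    by (rule subquotient_exists[OF B L(1,3)])
  interpret S: left_module R S by (rule S(1))
  interpret B: left_module R "M\<lparr>carrier := ?B\<rparr>" by (rule left_module_sub[OF B])
  have simple: "simple_module R S"
    unfolding simple_module_def
  proof (intro conjI allI impI S(1))
    have "q x \<in> carrier S" "q x \<noteq> \<zero>\<^bsub>S\<^esub>" using S(4,5) xB L(4) by auto
    then show "carrier S \<noteq> {\<zero>\<^bsub>S\<^esub>}" by auto
    fix T assume T: "submodule T R S"
    \<comment> \<open>The preimage of \<open>T\<close> contains \<open>L\<close>, so by maximality
      it is \<open>L\<close> or everything; as \<open>q\<close> is onto, \<open>T\<close> is
      accordingly zero or all of \<open>S\<close>.\<close>
    let ?T = "{y \<in> ?B. q y \<in> T}"
    have "submodule ?T R M" using B.submodule_vimage[OF S(3,1) T] submodule_sub_iff[OF B] by simp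
    moreover have z: "\<zero>\<^bsub>S\<^esub> \<in> T" using T by (simp add: S.submodule_iff)
    have "L \<subseteq> ?T"
    proof
      fix y assume y: "y \<in> L"
      then have "y \<in> ?B" "q y = \<zero>\<^bsub>S\<^esub>" using L(3) S(5) by blast+
      then show "y \<in> ?T" using z by simp
    qed
    ultimately consider "?T = L" | "?T = ?B" using L(5) by blast
    then show "T = {\<zero>\<^bsub>S\<^esub>} \<or> T = carrier S"
    proof cases
      case 1
      have "t = \<zero>\<^bsub>S\<^esub>" if "t \<in> T" for t
      proof -
        have "t \<in> q ` ?B" using that T S(4) by (auto simp: S.submodule_iff)
        then obtain y where "y \<in> ?B" "t = q y" by blast
        with 1 S(5) that show ?thesis by blast
      qed
      then show ?thesis using z by blast
    next
      case 2
      then have "q ` ?B \<subseteq> T" by blast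
      then show ?thesis using S(4) T by (auto simp: S.submodule_iff)
    qed
  qed
  have inj: "relatively_injective R M S" using cs simple S(2) unfolding co_semisimple_def by simp
  have "restrict q ?B \<in> lmod_hom R (M\<lparr>carrier := ?B\<rparr>) S"
    using B.lmod_hom_restrict[OF S(3)] by simp
  then have "\<exists>g\<in>lmod_hom R M S. \<forall>y\<in>?B. g y = restrict q ?B y"
    using inj B unfolding relatively_injective_def by blast
  then obtain g where g: "g \<in> lmod_hom R M S" "\<forall>y\<in>?B. g y = q y" by auto
  show thesis
  proof (rule that[OF S(1) inj lmod_hom_map[OF g(1)] S(3,4) g(2)])
    show "\<forall>y\<in>P. g y = \<zero>\<^bsub>S\<^esub>" using g(2) S(5) L(2) PB by blast
    show "g x \<noteq> \<zero>\<^bsub>S\<^esub>" using g(2) S(5) L(4) xB by auto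
  qed
qed

text \<open>The separating map \<open>g\<close> is lifted along \<open>q\<close> to
  \<open>h\<close>. As \<open>q\<close> vanishes on P while q (h x) = g x is nonzero,
  \<open>h x\<close> cannot lie in P.\<close>

lemma endomorphism_not_in_submodule:
  assumes pr: "projective_in_sigma R M" and cs: "co_semisimple R M"
    and P: "submodule P R M" and x: "x \<in> carrier M" "x \<notin> P"
  obtains h where "lmod_map R M M h" "h ` carrier M \<subseteq> P <+>\<^bsub>M\<^esub> cyclic x" "h x \<notin> P"
proof -
  let ?B = "P <+>\<^bsub>M\<^esub> cyclic x"
  note C = submodule_cyclic[OF x(1)]
  have B: "submodule ?B R M" by (rule submodule_set_add[OF P C])
  have PB: "P \<subseteq> ?B" by (rule set_add_upper1[OF P C])
  obtain S :: "('a, ('a, 'b) sigma_elem) module" and g q where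
    S: "left_module R S" "relatively_injective R M S" "lmod_map R M S g"
    "lmod_map R (M\<lparr>carrier := ?B\<rparr>) S q" "q ` ?B = carrier S"
    "\<forall>y\<in>?B. g y = q y" "\<forall>y\<in>P. g y = \<zero>\<^bsub>S\<^esub>" "g x \<noteq> \<zero>\<^bsub>S\<^esub>"
    by (rule co_semisimple_separation[OF cs P x])
  have "g ` carrier M \<subseteq> q ` ?B" using S(3,5) by (auto simp: lmod_map_def)
  from projective_lift[OF pr B S(4,1,3) this] obtain h where
    h: "lmod_map R M M h" "h ` carrier M \<subseteq> ?B" "\<forall>y\<in>carrier M. q (h y) = g y" by blast
  have "h x \<notin> P"
  proof
    assume hP: "h x \<in> P"
    then have "q (h x) = \<zero>\<^bsub>S\<^esub>" using S(6,7) PB by fastforce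
    then show False using h(3) x S(8) by simp
  qed
  then show thesis by (rule that[OF h(1,2)])
qed

text \<open>The case P = 0. It supplies, inside any nonzero submodule, the image of an endomorphism
  that does not kill a prescribed nonzero element of that submodule.\<close>

lemma endomorphism_nonzero:
  assumes pr: "projective_in_sigma R M" and cs: "co_semisimple R M"
    and x: "x \<in> carrier M" "x \<noteq> \<zero>\<^bsub>M\<^esub>"
  obtains h where "lmod_map R M M h" "h ` carrier M \<subseteq> cyclic x" "h x \<noteq> \<zero>\<^bsub>M\<^esub>"
proof -
  have "x \<notin> {\<zero>\<^bsub>M\<^esub>}" using x by simp
  from endomorphism_not_in_submodule[OF pr cs submodule_zero x(1) this] obtain h where
    h: "lmod_map R M M h" "h ` carrier M \<subseteq> {\<zero>\<^bsub>M\<^esub>} <+>\<^bsub>M\<^esub> cyclic x" "h x \<notin> {\<zero>\<^bsub>M\<^esub>}" .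
  moreover have "{\<zero>\<^bsub>M\<^esub>} <+>\<^bsub>M\<^esub> cyclic x \<subseteq> cyclic x"
    using submodule_cyclic[OF x(1)] by (intro set_add_least) (auto simp: submodule_iff)
  ultimately show thesis using that by blast
qed

lemma fully_invariant_eq_carrier:
  assumes pr: "projective_in_sigma R M" and cs: "co_semisimple R M"
    and P: "submodule P R M" and fi: "\<And>f. lmod_map R M M f \<Longrightarrow> f ` P \<subseteq> P"
    and f: "lmod_map R M M f" "inj_on f (carrier M)" "f ` carrier M \<subseteq> P"
  shows "P = carrier M"
proof (rule ccontr)
  assume "P \<noteq> carrier M"
  then obtain x where x: "x \<in> carrier M" "x \<notin> P" using P by (auto simp: submodule_iff)
  obtain S :: "('a, ('a, 'b) sigma_elem) module" and g q where
    S: "left_module R S" "relatively_injective R M S" "lmod_map R M S g"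
    "lmod_map R (M\<lparr>carrier := P <+>\<^bsub>M\<^esub> cyclic x\<rparr>) S q" "q ` (P <+>\<^bsub>M\<^esub> cyclic x) = carrier S"
    "\<forall>y\<in>P <+>\<^bsub>M\<^esub> cyclic x. g y = q y" "\<forall>y\<in>P. g y = \<zero>\<^bsub>S\<^esub>" "g x \<noteq> \<zero>\<^bsub>S\<^esub>"
    by (rule co_semisimple_separation[OF cs P x])
  \<comment> \<open>\<open>q\<close> is already onto on P + Rx, where it agrees with
    \<open>g\<close>. Hence \<open>g\<close> is onto and any map from \<open>M\<close> to
    \<open>S\<close> can be lifted along it.\<close>
  have gs: "carrier S \<subseteq> g ` carrier M"
  proof
    fix s assume "s \<in> carrier S"
    then obtain y where "y \<in> P <+>\<^bsub>M\<^esub> cyclic x" "s = q y" using S(5) by blast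
    moreover have "P <+>\<^bsub>M\<^esub> cyclic x \<subseteq> carrier M"
      using submodule_set_add[OF P submodule_cyclic[OF x(1)]] by (simp add: submodule_iff)
    ultimately show "s \<in> g ` carrier M" using S(6) by (metis image_eqI subsetD)
  qed
  let ?F = "f ` carrier M"
  have F: "submodule ?F R M" by (rule submodule_image[OF f(1) left_module_axioms])
  define i where "i = inv_into (carrier M) f"
  have i: "i (f y) = y" if "y \<in> carrier M" for y
    unfolding i_def by (rule inv_into_f_f[OF f(2) that])
  have "lmod_map R (M\<lparr>carrier := ?F\<rparr>) M i"
  proof (rule lmod_mapI)
    fix u v assume "u \<in> carrier (M\<lparr>carrier := ?F\<rparr>)" "v \<in> carrier (M\<lparr>carrier := ?F\<rparr>)"
    then obtain a b where *: "a \<in> carrier M" "u = f a" "b \<in> carrier M" "v = f b" by auto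
    then show "i (u \<oplus>\<^bsub>M\<lparr>carrier := ?F\<rparr>\<^esub> v) = i u \<oplus>\<^bsub>M\<^esub> i v"
      using i[of "a \<oplus>\<^bsub>M\<^esub> b"] lmod_mapD(2)[OF f(1), of a b] i by simp
  next
    fix r u assume r: "r \<in> carrier R" and "u \<in> carrier (M\<lparr>carrier := ?F\<rparr>)"
    then obtain a where *: "a \<in> carrier M" "u = f a" by auto
    then show "i (r \<odot>\<^bsub>M\<lparr>carrier := ?F\<rparr>\<^esub> u) = r \<odot>\<^bsub>M\<^esub> i u"
      using i[of "r \<odot>\<^bsub>M\<^esub> a"] lmod_mapD(3)[OF f(1), of r a] i r by simp
  qed (use i in auto)
  \<comment> \<open>On the submodule f(M) the map g composed with the inverse of \<open>f\<close> is
    defined; its extension \<open>h\<close> to \<open>M\<close> satisfies h f = g.\<close>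
  then have "lmod_map R (M\<lparr>carrier := ?F\<rparr>) S (\<lambda>y. g (i y))" by (rule lmod_map_comp[OF _ S(3)])
  then have "restrict (\<lambda>y. g (i y)) ?F \<in> lmod_hom R (M\<lparr>carrier := ?F\<rparr>) S"
    using left_module.lmod_hom_restrict[OF left_module_sub[OF F]] by fastforce
  then obtain h where h: "h \<in> lmod_hom R M S" "\<And>y. y \<in> ?F \<Longrightarrow> h y = restrict (\<lambda>y. g (i y)) ?F y"
    using S(2) F unfolding relatively_injective_def by blast
  have hm: "lmod_map R M S h" by (rule lmod_hom_map[OF h(1)])
  have g': "lmod_map R (M\<lparr>carrier := carrier M\<rparr>) S g" by (rule lmod_map_sub[OF S(3)]) simp
  have hg: "h ` carrier M \<subseteq> g ` carrier M" using gs hm by (auto simp: lmod_map_def)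
  from projective_lift[OF pr submodule_carrier g' S(1) hm hg]
  obtain u where u: "lmod_map R M M u" "\<forall>y\<in>carrier M. g (u y) = h y" by blast
  \<comment> \<open>\<open>f x\<close> lies in \<open>P\<close> and \<open>u\<close> preserves
    \<open>P\<close>, so h (f x) = g (u (f x)) = 0, against h (f x) = g x.\<close>
  have "u (f x) \<in> P" using fi[OF u(1)] f(3) x(1) by blast
  then have "h (f x) = \<zero>\<^bsub>S\<^esub>" using u(2) S(7) lmod_mapD(1)[OF f(1) x(1)] by metis
  moreover have "h (f x) = g x" using h(2)[of "f x"] x(1) i by simp
  ultimately show False using S(8) by simp
qed

end

section \<open>Monomorphisms into essential submodules\<close>

context left_module
begin

section \<open>Sums of families and finite uniform dimension\<close>

lemma submodule_submodule_sum:
  assumes "\<Union>\<U> \<subseteq> carrier M"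
  shows "submodule (submodule_sum R M \<U>) R M"
proof (rule submoduleI)
  show "submodule_sum R M \<U> \<subseteq> carrier M"
    using assms submodule_carrier by (auto simp: submodule_sum_def)
qed (auto simp: submodule_sum_def submodule_iff)

lemma submodule_sum_upper: "U \<in> \<U> \<Longrightarrow> U \<subseteq> submodule_sum R M \<U>"
  by (auto simp: submodule_sum_def)

lemma submodule_sum_least:
  "submodule L R M \<Longrightarrow> (\<And>U. U \<in> \<U> \<Longrightarrow> U \<subseteq> L) \<Longrightarrow> submodule_sum R M \<U> \<subseteq> L"
  by (auto simp: submodule_sum_def)

text \<open>Each U n splits off from D (Suc n), which contains all later members. So the U n form an
  infinite independent family.\<close>

lemma no_descending_complements:
  fixes U D :: "nat \<Rightarrow> 'b set"
  assumes fin: "finite_uniform_dim R M"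
    and U: "\<And>n. submodule (U n) R M" "\<And>n. U n \<subseteq> D n" "\<And>n. U n \<noteq> {\<zero>\<^bsub>M\<^esub>}"
    and D: "\<And>n. submodule (D n) R M" "\<And>n. D (Suc n) \<subseteq> D n"
    and UD: "\<And>n. U n \<inter> D (Suc n) = {\<zero>\<^bsub>M\<^esub>}"
  shows False
proof -
  have Dmono: "D m \<subseteq> D n" if "n \<le> m" for m n
    using that D(2) by (rule lift_Suc_antimono_le[of D, rotated])
  \<comment> \<open>F stands for the sum of the U i with i < n. If z = f + u lies in D (Suc n) with
    f in F and u in U n, then f = z - u lies in D n, so f = 0 and z = u lies in the zero
    intersection of U n and D (Suc n).\<close>
  have F: "\<exists>F. submodule F R M \<and> (\<forall>i<n. U i \<subseteq> F) \<and> F \<inter> D n = {\<zero>\<^bsub>M\<^esub>}" for n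
  proof (induction n)
    case 0
    show ?case using submodule_zero D(1)[of 0] by (intro exI[of _ "{\<zero>\<^bsub>M\<^esub>}"]) (auto simp: submodule_iff)
  next
    case (Suc n)
    then obtain F where F: "submodule F R M" "\<forall>i<n. U i \<subseteq> F" "F \<inter> D n = {\<zero>\<^bsub>M\<^esub>}" by blast
    let ?F = "F <+>\<^bsub>M\<^esub> U n"
    have sF: "submodule ?F R M" by (rule submodule_set_add[OF F(1) U(1)])
    moreover have "\<forall>i<Suc n. U i \<subseteq> ?F"
    proof (intro allI impI)
      fix i assume "i < Suc n"
      then consider "i < n" | "i = n" by linarith
      then show "U i \<subseteq> ?F"
        using F(2) set_add_upper1[OF F(1) U(1)] set_add_upper2[OF F(1) U(1)] by cases blast+
    qed
    moreover have "z = \<zero>\<^bsub>M\<^esub>" if z: "z \<in> ?F" "z \<in> D (Suc n)" for z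
    proof -
      obtain f u where fu: "f \<in> F" "u \<in> U n" "z = f \<oplus>\<^bsub>M\<^esub> u" using z(1) unfolding mem_set_add by blast
      have c: "f \<in> carrier M" "u \<in> carrier M" using fu F(1) U(1)[of n] by (auto simp: submodule_iff)
      have "z \<ominus>\<^bsub>M\<^esub> u \<in> D n" using submodule_minus[OF D(1)] z(2) D(2) fu(2) U(2) by blast
      moreover have "z \<ominus>\<^bsub>M\<^esub> u = f" using c fu(3) by (simp add: a_minus_def M.a_assoc M.r_neg)
      ultimately have "f = \<zero>\<^bsub>M\<^esub>" using fu(1) F(3) by auto
      then have "z = u" using fu(3) c by simp
      then show ?thesis using UD[of n] fu(2) z(2) by auto
    qed
    moreover have "\<zero>\<^bsub>M\<^esub> \<in> ?F \<inter> D (Suc n)" using sF D(1)[of "Suc n"] by (simp add: submodule_iff)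
    ultimately show ?case by (intro exI[of _ ?F]) blast
  qed
  have disj: "U m \<inter> U n = {\<zero>\<^bsub>M\<^esub>}" if "m < n" for m n
  proof -
    have "U n \<subseteq> D (Suc m)" using U(2)[of n] Dmono[of "Suc m" n] that by simp
    moreover have "\<zero>\<^bsub>M\<^esub> \<in> U m" "\<zero>\<^bsub>M\<^esub> \<in> U n" using U(1)[of m] U(1)[of n] by (simp_all add: submodule_iff)
    ultimately show ?thesis using UD[of m] by blast
  qed
  \<comment> \<open>Independence is a property of a set of submodules, so the range of
    \<open>U\<close> is infinite only because the members are pairwise distinct.\<close>
  have ne: "U m \<noteq> U n" if "m \<noteq> n" for m n
    using disj[of m n] disj[of n m] U(3) that by (metis inf.idem linorder_neqE_nat)
  then have inj: "inj U" by (auto simp: inj_on_def)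
  have "independent_submodules R M (range U)"
    unfolding independent_submodules_def
  proof
    fix V assume "V \<in> range U"
    then obtain n where V: "V = U n" by blast
    obtain F where F: "submodule F R M" "\<forall>i<n. U i \<subseteq> F" "F \<inter> D n = {\<zero>\<^bsub>M\<^esub>}" using F[of n] by blast
    let ?W = "F <+>\<^bsub>M\<^esub> D (Suc n)"
    \<comment> \<open>The earlier members lie in \<open>F\<close>, the later ones in D (Suc n). An
      element of U n in F + D (Suc n) vanishes by the same subtraction argument as above.\<close>
    have "submodule_sum R M (range U - {U n}) \<subseteq> ?W"
    proof (rule submodule_sum_least[OF submodule_set_add[OF F(1) D(1)]])
      fix W assume "W \<in> range U - {U n}"
      then obtain m where m: "W = U m" "m \<noteq> n" by blast
      show "W \<subseteq> ?W"
      proof (cases "m < n")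
        case True
        then show ?thesis using F(2) m set_add_upper1[OF F(1) D(1)] by blast
      next
        case False
        then have "U m \<subseteq> D (Suc n)" using U(2)[of m] Dmono[of "Suc n" m] m by simp
        then show ?thesis using m set_add_upper2[OF F(1) D(1)] by blast
      qed
    qed
    moreover have "z = \<zero>\<^bsub>M\<^esub>" if z: "z \<in> U n" "z \<in> ?W" for z
    proof -
      obtain f d where fd: "f \<in> F" "d \<in> D (Suc n)" "z = f \<oplus>\<^bsub>M\<^esub> d" using z(2) unfolding mem_set_add by blast
      have c: "f \<in> carrier M" "d \<in> carrier M" using fd F(1) D(1)[of "Suc n"] by (auto simp: submodule_iff)
      have "z \<ominus>\<^bsub>M\<^esub> d \<in> D n" using submodule_minus[OF D(1)] z(1) D(2) fd(2) U(2) by blast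
      moreover have "z \<ominus>\<^bsub>M\<^esub> d = f" using c fd(3) by (simp add: a_minus_def M.a_assoc M.r_neg)
      ultimately have "f = \<zero>\<^bsub>M\<^esub>" using fd(1) F(3) by auto
      then have "z = d" using fd(3) c by simp
      then show ?thesis using UD[of n] fd(2) z(1) by auto
    qed
    moreover have "\<zero>\<^bsub>M\<^esub> \<in> submodule_sum R M (range U - {U n})"
      by (auto simp: submodule_sum_def submodule_iff)
    moreover have "\<zero>\<^bsub>M\<^esub> \<in> U n" using U(1)[of n] by (simp add: submodule_iff)
    ultimately show "submodule V R M \<and> V \<inter> submodule_sum R M (range U - {V}) = {\<zero>\<^bsub>M\<^esub>}"
      unfolding V using U(1) by blast
  qed
  moreover have "{\<zero>\<^bsub>M\<^esub>} \<notin> range U" using U(3) by (metis rangeE)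
  ultimately have "finite (range U)" using fin unfolding finite_uniform_dim_def by blast
  then show False using inj by (simp add: finite_image_iff)
qed

section \<open>The chain condition and maps injective on their image\<close>

lemma left_annihilator_kernel:
  assumes "lmod_map R M M f"
  shows "left_annihilator R M {x \<in> carrier M. f x = \<zero>\<^bsub>M\<^esub>}"
  unfolding left_annihilator_def
  using lmod_hom_restrict[OF assms] by (intro exI[of _ "{restrict f (carrier M)}"]) auto

lemma acc_left_annihilators_maximal:
  assumes acc: "acc_left_annihilators R M" and "\<K> \<noteq> {}" and K: "\<And>L. L \<in> \<K> \<Longrightarrow> left_annihilator R M L"
  obtains L where "L \<in> \<K>" "\<forall>L'\<in>\<K>. L \<subseteq> L' \<longrightarrow> L' = L"
proof -
  have "\<exists>L\<in>\<K>. \<forall>L'\<in>\<K>. L \<subseteq> L' \<longrightarrow> L' = L"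
  proof (rule ccontr)
    assume c: "\<not> ?thesis"
    have "\<exists>f. \<forall>n. f n \<in> \<K> \<and> f n \<subset> f (Suc n)"
    proof (rule dependent_nat_choice)
      show "\<exists>x. x \<in> \<K>" using assms(2) by blast
      show "\<exists>y. y \<in> \<K> \<and> x \<subset> y" if "x \<in> \<K>" for x and n :: nat using c that by blast
    qed
    then obtain f where f: "\<And>n. f n \<in> \<K>" "\<And>n. f n \<subset> f (Suc n)" by blast
    then have "\<exists>n. \<forall>m\<ge>n. f m = f n" using acc K unfolding acc_left_annihilators_def by blast
    then obtain n where n: "\<forall>m\<ge>n. f m = f n" by blast
    have "f (Suc n) = f n" by (rule n[rule_format]) simp
    then show False using f(2)[of n] by blast
  qed
  then show thesis using that by blast
qed

lemma lmod_map_inj_on: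
  assumes "lmod_map R M C f" "left_module R C" "\<And>x. x \<in> carrier M \<Longrightarrow> f x = \<zero>\<^bsub>C\<^esub> \<Longrightarrow> x = \<zero>\<^bsub>M\<^esub>"
  shows "inj_on f (carrier M)"
proof (rule inj_onI)
  fix x y assume xy: "x \<in> carrier M" "y \<in> carrier M" "f x = f y"
  then have "f (x \<ominus>\<^bsub>M\<^esub> y) = \<zero>\<^bsub>C\<^esub>" using lmod_map_eq_iff[OF assms(1,2)] by blast
  then have "x \<ominus>\<^bsub>M\<^esub> y = \<zero>\<^bsub>M\<^esub>" using assms(3) xy by simp
  then show "x = y" using minus_eq_zero_iff xy by blast
qed

text \<open>Among the nonzero maps from \<open>M\<close> to \<open>U\<close>, choose
  \<open>a\<close> with maximal kernel. For a m nonzero, a map \<open>h\<close> into the cyclic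
  module of a m with h (a m) nonzero is injective on the image of \<open>a\<close>, which contains
  the image of \<open>h\<close>; so \<open>h\<close> is the required map.\<close>

lemma endomorphism_injective_on_image:
  assumes pr: "projective_in_sigma R M" and cs: "co_semisimple R M" and acc: "acc_left_annihilators R M"
    and U: "submodule U R M" "U \<noteq> {\<zero>\<^bsub>M\<^esub>}"
  obtains c where "lmod_map R M M c" "c ` carrier M \<subseteq> U" "c ` carrier M \<noteq> {\<zero>\<^bsub>M\<^esub>}"
    "\<forall>y\<in>carrier M. c (c y) = \<zero>\<^bsub>M\<^esub> \<longrightarrow> c y = \<zero>\<^bsub>M\<^esub>"
proof -
  let ?ker = "\<lambda>a. {x \<in> carrier M. a x = \<zero>\<^bsub>M\<^esub>}"
  define H where "H = {a. lmod_map R M M a \<and> a ` carrier M \<subseteq> U \<and> a ` carrier M \<noteq> {\<zero>\<^bsub>M\<^esub>}}"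
  have Hn: "h \<in> H" if "lmod_map R M M h" "h ` carrier M \<subseteq> U" "x \<in> carrier M" "h x \<noteq> \<zero>\<^bsub>M\<^esub>" for h x
    using that by (auto simp: H_def)
  have ex: "\<exists>h\<in>H. h ` carrier M \<subseteq> cyclic u \<and> h u \<noteq> \<zero>\<^bsub>M\<^esub>" if u: "u \<in> U" "u \<noteq> \<zero>\<^bsub>M\<^esub>" for u
  proof -
    have uc: "u \<in> carrier M" using u U by (auto simp: submodule_iff)
    obtain h where h: "lmod_map R M M h" "h ` carrier M \<subseteq> cyclic u" "h u \<noteq> \<zero>\<^bsub>M\<^esub>"
      by (rule endomorphism_nonzero[OF pr cs uc u(2)])
    then have "h \<in> H" using cyclic_subset[OF U(1) u(1)] by (intro Hn[OF h(1) _ uc]) auto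
    then show ?thesis using h by blast
  qed
  obtain u0 where "u0 \<in> U" "u0 \<noteq> \<zero>\<^bsub>M\<^esub>" using U by (auto simp: submodule_iff)
  then have "?ker ` H \<noteq> {}" using ex by blast
  moreover have "left_annihilator R M L" if "L \<in> ?ker ` H" for L
    using that by (auto simp: H_def intro: left_annihilator_kernel)
  ultimately obtain L where L: "L \<in> ?ker ` H" "\<forall>L'\<in>?ker ` H. L \<subseteq> L' \<longrightarrow> L' = L"
    by (rule acc_left_annihilators_maximal[OF acc])
  then obtain a where a: "a \<in> H" "L = ?ker a" by blast
  have am: "lmod_map R M M a" and aU: "a ` carrier M \<subseteq> U" using a(1) by (auto simp: H_def)
  have "\<zero>\<^bsub>M\<^esub> \<in> a ` carrier M" 
    by (rule image_eqI[where x = "\<zero>\<^bsub>M\<^esub>"]) (simp_all add: lmod_map_zero[OF am left_module_axioms])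
  then obtain m where m: "m \<in> carrier M" "a m \<noteq> \<zero>\<^bsub>M\<^esub>" using a(1) unfolding H_def by blast
  have mc: "a m \<in> carrier M" by (rule lmod_mapD(1)[OF am m(1)])
  obtain h where h: "h \<in> H" "h ` carrier M \<subseteq> cyclic (a m)" "h (a m) \<noteq> \<zero>\<^bsub>M\<^esub>"
    using ex[of "a m"] aU m by blast
  have hm: "lmod_map R M M h" and hU: "h ` carrier M \<subseteq> U" using h(1) by (auto simp: H_def)
  have haH: "(\<lambda>x. h (a x)) \<in> H"
    by (rule Hn[OF lmod_map_comp[OF am hm] _ m(1) h(3)]) (use hU am in \<open>auto simp: lmod_map_def\<close>)
  \<comment> \<open>The composite h a is nonzero at \<open>m\<close> and so belongs to
    \<open>H\<close>; its kernel contains that of \<open>a\<close>, and maximality makes them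
    equal.\<close>
  have "L \<subseteq> ?ker (\<lambda>x. h (a x))"
    using a(2) lmod_map_zero[OF hm left_module_axioms] by auto
  then have ker: "?ker (\<lambda>x. h (a x)) = ?ker a"
    using bspec[OF L(2) imageI[OF haH]] a(2) by simp
  have sq: "h y = \<zero>\<^bsub>M\<^esub>" if y: "y \<in> carrier M" "h (h y) = \<zero>\<^bsub>M\<^esub>" for y
  proof -
    \<comment> \<open>Every value of \<open>h\<close> is r (a m) = a (r m), hence a value of
      \<open>a\<close>, where the equality of kernels applies.\<close>
    have "h y \<in> cyclic (a m)" using h(2) y by blast
    then obtain r where r: "r \<in> carrier R" "h y = r \<odot>\<^bsub>M\<^esub> a m" by blast
    then have hy: "h y = a (r \<odot>\<^bsub>M\<^esub> m)" using lmod_mapD(3)[OF am r(1) m(1)] by simp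
    then have "r \<odot>\<^bsub>M\<^esub> m \<in> ?ker (\<lambda>x. h (a x))" using y(2) r m by simp
    then have "r \<odot>\<^bsub>M\<^esub> m \<in> ?ker a" using ker by simp
    then show ?thesis using hy by simp
  qed
  have "h ` carrier M \<noteq> {\<zero>\<^bsub>M\<^esub>}" using h(1) by (simp add: H_def)
  then show thesis using that[OF hm hU] sq by blast
qed

text \<open>Starting from zero, add to \<open>a\<close> a nonzero map \<open>c\<close> from
  \<open>M\<close> into the intersection of ker a and \<open>P\<close>. Each step cuts the kernel
  down by a submodule meeting c(M) trivially, so finite uniform dimension forces some kernel to be
  zero.\<close>

lemma essential_submodule_monomorphism:
  assumes pr: "projective_in_sigma R M" and cs: "co_semisimple R M" and gd: "goldie_module R M"
    and P: "submodule P R M"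
    and ess: "\<And>U. submodule U R M \<Longrightarrow> U \<inter> P = {\<zero>\<^bsub>M\<^esub>} \<Longrightarrow> U = {\<zero>\<^bsub>M\<^esub>}"
  obtains f where "lmod_map R M M f" "inj_on f (carrier M)" "f ` carrier M \<subseteq> P"
proof -
  have acc: "acc_left_annihilators R M" and fin: "finite_uniform_dim R M"
    using gd by (simp_all add: goldie_module_def)
  let ?ker = "\<lambda>a. {x \<in> carrier M. a x = \<zero>\<^bsub>M\<^esub>}"
  \<comment> \<open>The condition says that the image of \<open>a\<close> meets its kernel
    trivially; it is the invariant that keeps the sums under control.\<close>
  define good where "good a \<longleftrightarrow> lmod_map R M M a \<and> (\<forall>y\<in>carrier M. a (a y) = \<zero>\<^bsub>M\<^esub> \<longrightarrow> a y = \<zero>\<^bsub>M\<^esub>)" for a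
  define S where "S = {a. good a \<and> a ` carrier M \<subseteq> P}"
  define step where "step a a' \<longleftrightarrow> (\<exists>c. good c \<and> c ` carrier M \<subseteq> ?ker a \<inter> P \<and>
    c ` carrier M \<noteq> {\<zero>\<^bsub>M\<^esub>} \<and> a' = (\<lambda>y. a y \<oplus>\<^bsub>M\<^esub> c y))" for a a'
  note z = lmod_map_zero[OF _ left_module_axioms]
  have sum: "?ker (\<lambda>y. a y \<oplus>\<^bsub>M\<^esub> c y) = ?ker a \<inter> ?ker c \<and> (\<lambda>y. a y \<oplus>\<^bsub>M\<^esub> c y) \<in> S"
    if a: "a \<in> S" and c: "good c" "c ` carrier M \<subseteq> ?ker a \<inter> P" for a c
  proof -
    have am: "lmod_map R M M a" and cm: "lmod_map R M M c"
      and asq: "\<And>y. y \<in> carrier M \<Longrightarrow> a (a y) = \<zero>\<^bsub>M\<^esub> \<Longrightarrow> a y = \<zero>\<^bsub>M\<^esub>"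
      and csq: "\<And>y. y \<in> carrier M \<Longrightarrow> c (c y) = \<zero>\<^bsub>M\<^esub> \<Longrightarrow> c y = \<zero>\<^bsub>M\<^esub>"
      using a c by (auto simp: S_def good_def)
    note A = lmod_mapD[OF am] and C = lmod_mapD[OF cm]
    have ac: "a (c y) = \<zero>\<^bsub>M\<^esub>" if "y \<in> carrier M" for y using c(2) that by auto
    \<comment> \<open>Apply \<open>a\<close> to a y + c y = 0: since a c = 0, this leaves a (a y) =
      0, whence a y = 0 and then c y = 0.\<close>
    have k: "a y = \<zero>\<^bsub>M\<^esub> \<and> c y = \<zero>\<^bsub>M\<^esub>" if y: "y \<in> carrier M" "a y \<oplus>\<^bsub>M\<^esub> c y = \<zero>\<^bsub>M\<^esub>" for y
    proof -
      have "a (a y) = a (a y \<oplus>\<^bsub>M\<^esub> c y)" using A(1,2) C(1) ac y(1) by simp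
      then have "a (a y) = a \<zero>\<^bsub>M\<^esub>" using y(2) by simp
      then have "a y = \<zero>\<^bsub>M\<^esub>" using asq y z[OF am] by simp
      then show ?thesis using y C(1) by simp
    qed
    let ?s = "\<lambda>y. a y \<oplus>\<^bsub>M\<^esub> c y"
    have sm: "lmod_map R M M ?s"
      by (rule lmod_mapI) (simp_all add: A C M.a_ac smult_r_distr)
    \<comment> \<open>The sum is again injective on its image: \<open>k\<close> at the point a y + c
      y gives two equations. The first reduces to a (a y) = 0, so a y = 0; the second then becomes c
      (c y) = 0.\<close>
    have "a y \<oplus>\<^bsub>M\<^esub> c y = \<zero>\<^bsub>M\<^esub>" if y: "y \<in> carrier M" "?s (?s y) = \<zero>\<^bsub>M\<^esub>" for y
    proof -
      have "a (?s y) = \<zero>\<^bsub>M\<^esub>" "c (?s y) = \<zero>\<^bsub>M\<^esub>" using k[of "?s y"] y A C by auto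
      then have "a (a y) = \<zero>\<^bsub>M\<^esub>" using A C ac y by simp
      then have ay: "a y = \<zero>\<^bsub>M\<^esub>" using asq y by blast
      then have "c (c y) = \<zero>\<^bsub>M\<^esub>" using \<open>c (?s y) = \<zero>\<^bsub>M\<^esub>\<close> C y by simp
      then show ?thesis using csq[OF y(1)] ay by simp
    qed
    moreover have "?s ` carrier M \<subseteq> P"
    proof (rule image_subsetI)
      fix y assume "y \<in> carrier M"
      then have "a y \<in> P" "c y \<in> P" using a c(2) unfolding S_def by blast+
      then show "?s y \<in> P" using P by (simp add: submodule_iff)
    qed
    ultimately have "?s \<in> S" using sm by (auto simp: S_def good_def)
    moreover have "?ker ?s = ?ker a \<inter> ?ker c" using k by auto
    ultimately show ?thesis by blast
  qed
  have "\<exists>f\<in>S. inj_on f (carrier M)"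
  proof (rule ccontr)
    assume no: "\<not> ?thesis"
    have "\<exists>a. \<forall>n. a n \<in> S \<and> step (a n) (a (Suc n))"
    proof (rule dependent_nat_choice)
      have "(\<lambda>_. \<zero>\<^bsub>M\<^esub>) \<in> S"
        using P by (auto simp: S_def good_def lmod_map_def submodule_iff)
      then show "\<exists>x. x \<in> S" by blast
    next
      fix a and n :: nat assume a: "a \<in> S"
      then have am: "lmod_map R M M a" by (simp add: S_def good_def)
      have ks: "submodule (?ker a) R M" by (rule submodule_kernel[OF am left_module_axioms])
      \<comment> \<open>\<open>a\<close> is not injective by assumption, so essentiality of
        \<open>P\<close> leaves room for a further map \<open>c\<close> inside ker a and
        \<open>P\<close>.\<close>
      have "?ker a \<noteq> {\<zero>\<^bsub>M\<^esub>}"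
        using no a lmod_map_inj_on[OF am left_module_axioms] by blast
      then have ne: "?ker a \<inter> P \<noteq> {\<zero>\<^bsub>M\<^esub>}" using ess[OF ks] by blast
      obtain c where c: "lmod_map R M M c" "c ` carrier M \<subseteq> ?ker a \<inter> P" "c ` carrier M \<noteq> {\<zero>\<^bsub>M\<^esub>}"
        "\<forall>y\<in>carrier M. c (c y) = \<zero>\<^bsub>M\<^esub> \<longrightarrow> c y = \<zero>\<^bsub>M\<^esub>"
        by (rule endomorphism_injective_on_image[OF pr cs acc submodule_Int[OF ks P] ne])
      have gc: "good c" using c by (simp add: good_def)
      show "\<exists>y. y \<in> S \<and> step a y"
      proof (intro exI conjI)
        show "(\<lambda>y. a y \<oplus>\<^bsub>M\<^esub> c y) \<in> S" using sum[OF a gc c(2)] by blast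
        show "step a (\<lambda>y. a y \<oplus>\<^bsub>M\<^esub> c y)" unfolding step_def using gc c(2,3) by blast
      qed
    qed
    then obtain a where a: "\<And>n. a n \<in> S" "\<And>n. step (a n) (a (Suc n))" by blast
    define stp where "stp n c \<longleftrightarrow> good c \<and> c ` carrier M \<subseteq> ?ker (a n) \<inter> P \<and>
      c ` carrier M \<noteq> {\<zero>\<^bsub>M\<^esub>} \<and> a (Suc n) = (\<lambda>y. a n y \<oplus>\<^bsub>M\<^esub> c y)" for n c
    have "\<forall>n. \<exists>c. stp n c" using a(2) unfolding step_def stp_def by (rule allI)
    then obtain c where "\<forall>n. stp n (c n)" using choice[of stp] by blast
    then have c: "\<And>n. good (c n)" "\<And>n. c n ` carrier M \<subseteq> ?ker (a n) \<inter> P"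
      "\<And>n. c n ` carrier M \<noteq> {\<zero>\<^bsub>M\<^esub>}" "\<And>n. a (Suc n) = (\<lambda>y. a n y \<oplus>\<^bsub>M\<^esub> c n y)"
      unfolding stp_def by simp_all
    have cm: "lmod_map R M M (c n)" for n using c(1) by (simp add: good_def)
    have am: "lmod_map R M M (a n)" for n using a(1) by (simp add: S_def good_def)
    have ker: "?ker (a (Suc n)) = ?ker (a n) \<inter> ?ker (c n)" for n
      unfolding c(4) using sum[OF a(1) c(1,2)] by (rule conjunct1)
    show False
    proof (rule no_descending_complements[OF fin, where U = "\<lambda>n. c n ` carrier M" and D = "\<lambda>n. ?ker (a n)"])
      fix n
      show "submodule (c n ` carrier M) R M" by (rule submodule_image[OF cm left_module_axioms])
      show "submodule (?ker (a n)) R M" by (rule submodule_kernel[OF am left_module_axioms])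
      show "c n ` carrier M \<subseteq> ?ker (a n)" using c(2) by blast
      show "?ker (a (Suc n)) \<subseteq> ?ker (a n)" unfolding ker by blast
      have "\<zero>\<^bsub>M\<^esub> \<in> c n ` carrier M"
        by (rule image_eqI[where x = "\<zero>\<^bsub>M\<^esub>"]) (simp_all add: z[OF cm])
      moreover have "\<zero>\<^bsub>M\<^esub> \<in> ?ker (a (Suc n))" using z[OF am] by simp
      \<comment> \<open>Such a y lies in the image of c n and, by \<open>ker\<close>, in its kernel;
        goodness of c n makes it zero.\<close>
      moreover have "y = \<zero>\<^bsub>M\<^esub>" if "y \<in> c n ` carrier M" "y \<in> ?ker (a (Suc n))" for y
        using that c(1)[of n] unfolding ker good_def by blast
      ultimately show "c n ` carrier M \<inter> ?ker (a (Suc n)) = {\<zero>\<^bsub>M\<^esub>}" by blast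
    qed (rule c(3))
  qed
  then show thesis using that unfolding S_def good_def by blast
qed

end

section \<open>Splitting and the factor module\<close>

context left_module
begin

text \<open>The complement is the annihilator \<open>C\<close> of \<open>N\<close>, the common
  kernel of all maps from \<open>M\<close> to \<open>N\<close>. The sum N + C is fully invariant and
  essential, so it receives a monomorphism from \<open>M\<close> and equals
  \<open>M\<close>.\<close>

lemma fully_invariant_complement:
  assumes pr: "projective_in_sigma R M" and cs: "co_semisimple R M" and gd: "goldie_module R M"
    and N: "fully_invariant R M N"
  obtains C where "submodule C R M" "N \<inter> C = {\<zero>\<^bsub>M\<^esub>}" "N <+>\<^bsub>M\<^esub> C = carrier M"
proof -
  have sN: "submodule N R M" using N by (simp add: fully_invariant_def)
  have fiN: "f y \<in> N" if "lmod_map R M M f" "y \<in> N" for f y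
  proof -
    have "restrict f (carrier M) ` N \<subseteq> N"
      using N lmod_hom_restrict[OF that(1)] unfolding fully_invariant_def by blast
    moreover have "y \<in> carrier M" using that(2) sN by (auto simp: submodule_iff)
    ultimately show ?thesis using that(2) by auto
  qed
  define C where "C = {x \<in> carrier M. \<forall>f. lmod_map R M M f \<longrightarrow> f ` carrier M \<subseteq> N \<longrightarrow> f x = \<zero>\<^bsub>M\<^esub>}"
  have sC: "submodule C R M"
  proof (rule submoduleI)
    show "\<zero>\<^bsub>M\<^esub> \<in> C" using lmod_map_zero[OF _ left_module_axioms] by (simp add: C_def)
    fix x y assume xy: "x \<in> C" "y \<in> C"
    have "f (x \<oplus>\<^bsub>M\<^esub> y) = \<zero>\<^bsub>M\<^esub>" if f: "lmod_map R M M f" "f ` carrier M \<subseteq> N" for f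
    proof -
      have "f x = \<zero>\<^bsub>M\<^esub>" "f y = \<zero>\<^bsub>M\<^esub>" using xy f unfolding C_def by blast+
      then show ?thesis using lmod_mapD(2)[OF f(1), of x y] xy by (simp add: C_def)
    qed
    then show "x \<oplus>\<^bsub>M\<^esub> y \<in> C" using xy by (simp add: C_def)
  next
    fix r x assume rx: "r \<in> carrier R" "x \<in> C"
    have "f (r \<odot>\<^bsub>M\<^esub> x) = \<zero>\<^bsub>M\<^esub>" if f: "lmod_map R M M f" "f ` carrier M \<subseteq> N" for f
    proof -
      have "f x = \<zero>\<^bsub>M\<^esub>" using rx f unfolding C_def by blast
      then show ?thesis using lmod_mapD(3)[OF f(1), of r x] rx by (simp add: C_def)
    qed
    then show "r \<odot>\<^bsub>M\<^esub> x \<in> C" using rx by (simp add: C_def)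
  qed (auto simp: C_def)
  have fiC: "g y \<in> C" if g: "lmod_map R M M g" "y \<in> C" for g y
  proof -
    have yc: "y \<in> carrier M" using g(2) by (simp add: C_def)
    have "f (g y) = \<zero>\<^bsub>M\<^esub>" if f: "lmod_map R M M f" "f ` carrier M \<subseteq> N" for f
    proof -
      \<comment> \<open>Preceding a map into \<open>N\<close> by an endomorphism gives another map
        into \<open>N\<close>; hence \<open>C\<close> is fully invariant.\<close>
      have "(\<lambda>x. f (g x)) ` carrier M \<subseteq> N" using f(2) lmod_mapD(1)[OF g(1)] by blast
      then show ?thesis using g(2) lmod_map_comp[OF g(1) f(1)] unfolding C_def by blast
    qed
    then show ?thesis using lmod_mapD(1)[OF g(1) yc] by (simp add: C_def)
  qed
  have z: "\<zero>\<^bsub>M\<^esub> \<in> N" "\<zero>\<^bsub>M\<^esub> \<in> C" using sN sC by (simp_all add: submodule_iff)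
  have Nc: "x \<in> carrier M" if "x \<in> N" for x using sN that by (auto simp: submodule_iff)
  have NC: "N \<inter> C = {\<zero>\<^bsub>M\<^esub>}"
  proof -
    have "x = \<zero>\<^bsub>M\<^esub>" if x: "x \<in> N" "x \<in> C" for x
    proof (rule ccontr)
      assume "x \<noteq> \<zero>\<^bsub>M\<^esub>"
      then obtain h where h: "lmod_map R M M h" "h ` carrier M \<subseteq> cyclic x" "h x \<noteq> \<zero>\<^bsub>M\<^esub>"
        by (rule endomorphism_nonzero[OF pr cs Nc[OF x(1)]])
      have "h ` carrier M \<subseteq> N" using h(2) cyclic_subset[OF sN x(1)] by blast
      then show False using x(2) h(1,3) unfolding C_def by blast
    qed
    then show ?thesis using z by blast
  qed
  let ?P = "N <+>\<^bsub>M\<^esub> C"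
  have sP: "submodule ?P R M" by (rule submodule_set_add[OF sN sC])
  have ess: "U = {\<zero>\<^bsub>M\<^esub>}" if U: "submodule U R M" "U \<inter> ?P = {\<zero>\<^bsub>M\<^esub>}" for U
  proof -
    have "U \<inter> N \<subseteq> {\<zero>\<^bsub>M\<^esub>}" using U(2) set_add_upper1[OF sN sC] by blast
    \<comment> \<open>A submodule \<open>U\<close> with zero intersection with \<open>N\<close> is
      annihilated by every map from \<open>M\<close> to \<open>N\<close>; thus U lies in
      \<open>C\<close>, hence in N + C, and is zero.\<close>
    have "x \<in> C" if x: "x \<in> U" for x
    proof (rule ccontr)
      assume "x \<notin> C"
      have xc: "x \<in> carrier M" using x U(1) by (auto simp: submodule_iff)
      obtain f where f: "lmod_map R M M f" "f ` carrier M \<subseteq> N" "f x \<noteq> \<zero>\<^bsub>M\<^esub>"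
        using xc \<open>x \<notin> C\<close> unfolding C_def by blast
      have fx: "f x \<in> carrier M" "f x \<in> N" using f xc lmod_mapD(1)[OF f(1)] by auto
      obtain h where h: "lmod_map R M M h" "h ` carrier M \<subseteq> cyclic (f x)" "h (f x) \<noteq> \<zero>\<^bsub>M\<^esub>"
        by (rule endomorphism_nonzero[OF pr cs fx(1) f(3)])
      have "cyclic (f x) \<subseteq> f ` cyclic x"
        using lmod_mapD(3)[OF f(1) _ xc] by (auto simp: image_image)
      then have hf: "h ` carrier M \<subseteq> f ` cyclic x" using h(2) by blast
      have fs: "lmod_map R (M\<lparr>carrier := cyclic x\<rparr>) M f"
        by (rule lmod_map_sub[OF f(1)]) (use xc in auto)
      \<comment> \<open>Lifting \<open>h\<close> along f from Rx onto R (f x) gives \<open>u\<close>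
        with image in \<open>U\<close>. As \<open>u\<close> preserves \<open>N\<close>, the element
        u (f x) lies in both U and \<open>N\<close> and vanishes, which contradicts f (u (f x)) = h
        (f x) being nonzero.\<close>
      obtain u where u: "lmod_map R M M u" "u ` carrier M \<subseteq> cyclic x" "\<forall>y\<in>carrier M. f (u y) = h y"
        using projective_lift[OF pr submodule_cyclic[OF xc] fs left_module_axioms h(1) hf] by blast
      have "u (f x) \<in> U" using u(2) fx(1) cyclic_subset[OF U(1) x] by blast
      moreover have "u (f x) \<in> N" by (rule fiN[OF u(1) fx(2)])
      ultimately have "u (f x) = \<zero>\<^bsub>M\<^esub>" using \<open>U \<inter> N \<subseteq> {\<zero>\<^bsub>M\<^esub>}\<close> by blast
      then have "h (f x) = \<zero>\<^bsub>M\<^esub>" using u(3) fx(1) lmod_map_zero[OF f(1) left_module_axioms] by metis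
      then show False using h(3) by simp
    qed
    then have "U \<subseteq> ?P" using set_add_upper2[OF sN sC] by blast
    then show ?thesis using U(2) by blast
  qed
  have fiP: "g ` ?P \<subseteq> ?P" if g: "lmod_map R M M g" for g
  proof (rule image_subsetI)
    fix y assume "y \<in> ?P"
    then obtain n c where y: "n \<in> N" "c \<in> C" "y = n \<oplus>\<^bsub>M\<^esub> c" unfolding mem_set_add by blast
    then have "g y = g n \<oplus>\<^bsub>M\<^esub> g c" using Nc lmod_mapD(2)[OF g, of n c] by (simp add: C_def)
    then show "g y \<in> ?P" unfolding mem_set_add using fiN[OF g y(1)] fiC[OF g y(2)] by blast
  qed
  obtain f where f: "lmod_map R M M f" "inj_on f (carrier M)" "f ` carrier M \<subseteq> ?P"
    by (rule essential_submodule_monomorphism[OF pr cs gd sP ess])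
  have "?P = carrier M" by (rule fully_invariant_eq_carrier[OF pr cs sP fiP f])
  then show thesis by (rule that[OF sC NC])
qed

section \<open>Maps out of the factor module and semiprimeness\<close>

lemma coset_lmod_map_factor:
  assumes N: "submodule N R M" and g: "lmod_map R M C g" and C: "left_module R C"
    and z: "\<And>n. n \<in> N \<Longrightarrow> g n = \<zero>\<^bsub>C\<^esub>"
  obtains h where "lmod_map R (quot_module M N) C h" "\<forall>y\<in>carrier M. h (N +>\<^bsub>M\<^esub> y) = g y"
proof -
  \<comment> \<open>The value is taken at a chosen representative; two representatives differ by an
    element of \<open>N\<close>, which \<open>g\<close> kills.\<close>
  define h where "h Y = g (SOME y. y \<in> carrier M \<and> N +>\<^bsub>M\<^esub> y = Y)" for Y
  have h: "h (N +>\<^bsub>M\<^esub> y) = g y" if y: "y \<in> carrier M" for y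
  proof -
    let ?s = "SOME x. x \<in> carrier M \<and> N +>\<^bsub>M\<^esub> x = N +>\<^bsub>M\<^esub> y"
    have s: "?s \<in> carrier M \<and> N +>\<^bsub>M\<^esub> ?s = N +>\<^bsub>M\<^esub> y" by (rule someI) (use y in simp)
    then have "?s \<ominus>\<^bsub>M\<^esub> y \<in> N" using coset_eq_iff[OF N y] by blast
    then have "g ?s = g y" using lmod_map_eq_iff[OF g C] s y z by blast
    then show ?thesis by (simp add: h_def)
  qed
  have "lmod_map R (quot_module M N) C h"
  proof (rule lmod_mapI; (unfold quot_carrier)?)
    fix X assume "X \<in> (\<lambda>x. N +>\<^bsub>M\<^esub> x) ` carrier M"
    then show "h X \<in> carrier C" using h lmod_mapD(1)[OF g] by auto
  next
    fix X Y assume "X \<in> (\<lambda>x. N +>\<^bsub>M\<^esub> x) ` carrier M" "Y \<in> (\<lambda>x. N +>\<^bsub>M\<^esub> x) ` carrier M"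
    then obtain x y where *: "x \<in> carrier M" "X = N +>\<^bsub>M\<^esub> x" "y \<in> carrier M" "Y = N +>\<^bsub>M\<^esub> y" by blast
    then show "h (X \<oplus>\<^bsub>quot_module M N\<^esub> Y) = h X \<oplus>\<^bsub>C\<^esub> h Y"
      by (simp add: quot_add[OF N] h lmod_mapD(2)[OF g])
  next
    fix r X assume r: "r \<in> carrier R" and "X \<in> (\<lambda>x. N +>\<^bsub>M\<^esub> x) ` carrier M"
    then obtain x where *: "x \<in> carrier M" "X = N +>\<^bsub>M\<^esub> x" by blast
    then show "h (r \<odot>\<^bsub>quot_module M N\<^esub> X) = r \<odot>\<^bsub>C\<^esub> h X"
      by (simp add: quot_smult[OF N] h lmod_mapD(3)[OF g] r)
  qed
  then show thesis using that h by blast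
qed

lemma semiprime_quot:
  assumes pr: "projective_in_sigma R M" and cs: "co_semisimple R M" and N: "fully_invariant R M N"
  shows "semiprime_module R (quot_module M N)"
  unfolding semiprime_module_def
proof (intro allI impI, rule ccontr)
  let ?X = "quot_module M N"
  fix K assume "fully_invariant R ?X K" and prod: "submodule_prod R ?X K K = {\<zero>\<^bsub>?X\<^esub>}"
    and ne: "K \<noteq> {\<zero>\<^bsub>?X\<^esub>}"
  have sN: "submodule N R M" using N by (simp add: fully_invariant_def)
  interpret X: left_module R ?X by (rule left_module_quot[OF sN])
  have sK: "submodule K R ?X" using \<open>fully_invariant R ?X K\<close> by (simp add: fully_invariant_def)
  then have "N \<in> K" "K \<subseteq> carrier ?X" by (simp_all add: X.submodule_iff)
  then obtain k where "k \<in> K" "k \<noteq> N" using ne by auto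
  then obtain x where x: "x \<in> carrier M" "k = N +>\<^bsub>M\<^esub> x"
    using \<open>K \<subseteq> carrier ?X\<close> by (auto simp: quot_carrier)
  have "x \<notin> N" using x \<open>k \<noteq> N\<close> coset_eq_self_iff[OF sN] by blast
  \<comment> \<open>\<open>x\<close> represents a nonzero element \<open>k\<close> of
    \<open>K\<close>. The endomorphism induced by \<open>h\<close> on M/N will map into
    \<open>K\<close> without killing \<open>k\<close>, so it witnesses that the product of
    \<open>K\<close> with itself is nonzero.\<close>
  obtain h where h: "lmod_map R M M h" "h ` carrier M \<subseteq> N <+>\<^bsub>M\<^esub> cyclic x" "h x \<notin> N"
    by (rule endomorphism_not_in_submodule[OF pr cs sN x(1) \<open>x \<notin> N\<close>])
  have hc: "h y \<in> carrier M" if "y \<in> carrier M" for y by (rule lmod_mapD(1)[OF h(1) that])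
  have hN: "N +>\<^bsub>M\<^esub> h n = \<zero>\<^bsub>?X\<^esub>" if n: "n \<in> N" for n
  proof -
    have nc: "n \<in> carrier M" using n sN by (auto simp: submodule_iff)
    have "restrict h (carrier M) ` N \<subseteq> N"
      using N lmod_hom_restrict[OF h(1)] unfolding fully_invariant_def by blast
    then have "h n \<in> N" using n nc by auto
    then show ?thesis using coset_eq_self_iff[OF sN hc[OF nc]] by simp
  qed
  obtain g where g: "lmod_map R ?X ?X g" "\<forall>y\<in>carrier M. g (N +>\<^bsub>M\<^esub> y) = N +>\<^bsub>M\<^esub> h y"
    by (rule coset_lmod_map_factor[OF sN lmod_map_comp[OF h(1) lmod_map_quot[OF sN]] X.left_module_axioms hN])
  have gK: "g Y \<in> K" if Y: "Y \<in> carrier ?X" for Y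
  proof -
    obtain y where y: "y \<in> carrier M" "Y = N +>\<^bsub>M\<^esub> y" using Y by (auto simp: quot_carrier)
    have "h y \<in> N <+>\<^bsub>M\<^esub> cyclic x" using h(2) y(1) by blast
    then obtain n r where nr: "n \<in> N" "r \<in> carrier R" "h y = n \<oplus>\<^bsub>M\<^esub> r \<odot>\<^bsub>M\<^esub> x"
      unfolding mem_set_add by blast
    have nc: "n \<in> carrier M" using nr(1) sN by (auto simp: submodule_iff)
    have "h y \<ominus>\<^bsub>M\<^esub> r \<odot>\<^bsub>M\<^esub> x = n"
      using nr nc x(1) by (simp add: a_minus_def M.a_assoc M.r_neg)
    \<comment> \<open>Modulo \<open>N\<close> the image of \<open>h\<close> shrinks from N + Rx to
      the cyclic submodule generated by \<open>k\<close>, which lies in \<open>K\<close>.\<close>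
    then have "N +>\<^bsub>M\<^esub> h y = N +>\<^bsub>M\<^esub> (r \<odot>\<^bsub>M\<^esub> x)"
      using coset_eq_iff[OF sN _ hc[OF y(1)]] nr x(1) by simp
    then have "g Y = r \<odot>\<^bsub>?X\<^esub> k" using g(2) y x nr(2) by (simp add: quot_smult[OF sN])
    then show ?thesis using sK \<open>k \<in> K\<close> nr(2) by (simp add: X.submodule_iff)
  qed
  have "lmod_map R ?X (?X\<lparr>carrier := K\<rparr>) g" by (rule lmod_map_into[OF g(1) gK])
  then have "restrict g (carrier ?X) \<in> lmod_hom R ?X (?X\<lparr>carrier := K\<rparr>)" by (rule X.lmod_hom_restrict)
  \<comment> \<open>The product contains g(K); being zero, it forces g k = 0, that is,
    \<open>h x\<close> in \<open>N\<close>.\<close>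
  then have "restrict g (carrier ?X) ` K \<subseteq> submodule_prod R ?X K K"
    unfolding submodule_prod_def by (intro X.submodule_sum_upper) blast
  then have "restrict g (carrier ?X) k = N" using \<open>k \<in> K\<close> unfolding prod by auto
  then have "N +>\<^bsub>M\<^esub> h x = N" using g(2) x by (simp add: quot_carrier)
  then show False using h(3) coset_eq_self_iff[OF sN hc[OF x(1)]] by blast
qed

section \<open>Transfer of the Goldie conditions to a direct summand\<close>

lemma finite_uniform_dim_embedded:
  assumes fin: "finite_uniform_dim R M" and X: "left_module R X"
    and f: "lmod_map R X M f" "inj_on f (carrier X)"
  shows "finite_uniform_dim R X"
  unfolding finite_uniform_dim_def
proof (intro allI impI)
  interpret X: left_module R X by fact
  fix \<U> assume ind: "independent_submodules R X \<U>" and z: "{\<zero>\<^bsub>X\<^esub>} \<notin> \<U>"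
  have U: "submodule U R X" "U \<subseteq> carrier X" "\<zero>\<^bsub>X\<^esub> \<in> U" "U \<inter> submodule_sum R X (\<U> - {U}) = {\<zero>\<^bsub>X\<^esub>}"
    if "U \<in> \<U>" for U
    using ind that by (auto simp: independent_submodules_def X.submodule_iff)
  have f0: "f \<zero>\<^bsub>X\<^esub> = \<zero>\<^bsub>M\<^esub>" by (rule X.lmod_map_zero[OF f(1) left_module_axioms])
  \<comment> \<open>Distinct members have distinct images, so finiteness of the family of images
    gives finiteness of the original family.\<close>
  have inj: "inj_on ((`) f) \<U>"
    using U(2) by (intro inj_onI) (metis f(2) inj_on_image_eq_iff)
  have "independent_submodules R M ((`) f ` \<U>)"
    unfolding independent_submodules_def
  proof
    fix V assume "V \<in> (`) f ` \<U>"
    then obtain U0 where U0: "U0 \<in> \<U>" "V = f ` U0" by blast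
    have V: "submodule V R M" unfolding U0(2)
      by (rule X.submodule_image_sub[OF U(1)[OF U0(1)] lmod_map_sub[OF f(1) U(2)[OF U0(1)]] left_module_axioms])
    let ?T = "submodule_sum R X (\<U> - {U0})"
    have T: "submodule ?T R X" using U(2) by (intro X.submodule_submodule_sum) blast
    have fT: "submodule (f ` ?T) R M"
      by (rule X.submodule_image_sub[OF T lmod_map_sub[OF f(1)] left_module_axioms])
        (use T in \<open>simp add: X.submodule_iff\<close>)
    \<comment> \<open>The sum of the other images lies in the image of the sum of the other members;
      injectivity of \<open>f\<close> then carries the trivial intersection over to
      \<open>M\<close>.\<close>
    have le: "submodule_sum R M ((`) f ` \<U> - {V}) \<subseteq> f ` ?T"
    proof (rule submodule_sum_least[OF fT])
      fix W assume "W \<in> (`) f ` \<U> - {V}"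
      then obtain U1 where "U1 \<in> \<U> - {U0}" "W = f ` U1" using U0(2) by blast
      then show "W \<subseteq> f ` ?T" using X.submodule_sum_upper[of U1] by (simp add: image_mono)
    qed
    have "v = \<zero>\<^bsub>M\<^esub>" if v: "v \<in> V" "v \<in> submodule_sum R M ((`) f ` \<U> - {V})" for v
    proof -
      obtain u where u: "u \<in> U0" "v = f u" using v(1) U0(2) by blast
      obtain t where t: "t \<in> ?T" "v = f t" using v(2) le by blast
      have "u \<in> carrier X" "t \<in> carrier X" using u(1) U(2)[OF U0(1)] t(1) T by (auto simp: X.submodule_iff)
      then have "u = t" using f(2) u(2) t(2) by (auto simp: inj_on_def)
      then have "u = \<zero>\<^bsub>X\<^esub>" using U(4)[OF U0(1)] u(1) t(1) by blast
      then show ?thesis using u(2) f0 by simp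
    qed
    moreover have "\<zero>\<^bsub>M\<^esub> \<in> V" using V by (simp add: submodule_iff)
    moreover have "\<zero>\<^bsub>M\<^esub> \<in> submodule_sum R M ((`) f ` \<U> - {V})"
      by (auto simp: submodule_sum_def submodule_iff)
    ultimately show "submodule V R M \<and> V \<inter> submodule_sum R M ((`) f ` \<U> - {V}) = {\<zero>\<^bsub>M\<^esub>}"
      using V by blast
  qed
  moreover have "{\<zero>\<^bsub>M\<^esub>} \<notin> (`) f ` \<U>"
  proof
    assume "{\<zero>\<^bsub>M\<^esub>} \<in> (`) f ` \<U>"
    then obtain U0 where U0: "U0 \<in> \<U>" "f ` U0 = {\<zero>\<^bsub>M\<^esub>}" by auto
    have "f ` U0 = f ` {\<zero>\<^bsub>X\<^esub>}" using U0(2) f0 by simp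
    then have "U0 = {\<zero>\<^bsub>X\<^esub>}" using f(2) U(2)[OF U0(1)]
      by (subst (asm) inj_on_image_eq_iff[of f "carrier X"]) auto
    then show False using z U0(1) by blast
  qed
  ultimately have "finite ((`) f ` \<U>)" using fin unfolding finite_uniform_dim_def by blast
  then show "finite \<U>" using inj by (rule finite_imageD)
qed

text \<open>Uniform dimension passes down along the embedding \<open>s\<close>. An endomorphism f of
  \<open>X\<close> becomes s f p on \<open>M\<close>, whose kernel is the preimage of ker f under
  \<open>p\<close>; so preimages of left annihilators are left annihilators, and the chain condition
  is pulled back along \<open>p\<close>.\<close>

lemma goldie_direct_summand:
  assumes gd: "goldie_module R M" and X: "left_module R X"
    and p: "lmod_map R M X p" "p ` carrier M = carrier X"
    and s: "lmod_map R X M s" "inj_on s (carrier X)"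
  shows "goldie_module R X"
  unfolding goldie_module_def
proof
  interpret X: left_module R X by fact
  show "finite_uniform_dim R X"
    using finite_uniform_dim_embedded[OF _ X s] gd by (simp add: goldie_module_def)
  have s0: "s x = \<zero>\<^bsub>M\<^esub> \<longleftrightarrow> x = \<zero>\<^bsub>X\<^esub>" if "x \<in> carrier X" for x
    using inj_on_eq_iff[OF s(2) that X.M.zero_closed] X.lmod_map_zero[OF s(1) left_module_axioms] by simp
  let ?v = "\<lambda>L. {x \<in> carrier M. p x \<in> L}"
  have ann: "left_annihilator R M (?v L)" if L: "left_annihilator R X L" for L
  proof -
    obtain Y where Y: "Y \<subseteq> lmod_end R X" "L = {x \<in> carrier X. \<forall>f\<in>Y. f x = \<zero>\<^bsub>X\<^esub>}"
      using L unfolding left_annihilator_def by blast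
    define lft where "lft f = restrict (\<lambda>x. s (f (p x))) (carrier M)" for f
    have pc: "p x \<in> carrier X" if "x \<in> carrier M" for x by (rule lmod_mapD(1)[OF p(1) that])
    have Ym: "lmod_map R X X f" if "f \<in> Y" for f
      by (rule lmod_hom_map) (use Y(1) that in auto)
    have fc: "f (p x) \<in> carrier X" if "f \<in> Y" "x \<in> carrier M" for f x
      by (rule lmod_mapD(1)[OF Ym[OF that(1)] pc[OF that(2)]])
    have "lft f \<in> lmod_end R M" if "f \<in> Y" for f
      unfolding lft_def
      by (rule lmod_hom_restrict[OF lmod_map_comp[OF lmod_map_comp[OF p(1) Ym[OF that]] s(1)]])
    moreover have "?v L = {x \<in> carrier M. \<forall>f\<in>lft ` Y. f x = \<zero>\<^bsub>M\<^esub>}"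
    proof (rule Collect_cong, rule conj_cong[OF refl])
      fix x assume x: "x \<in> carrier M"
      have "(\<forall>f\<in>lft ` Y. f x = \<zero>\<^bsub>M\<^esub>) \<longleftrightarrow> (\<forall>f\<in>Y. f (p x) = \<zero>\<^bsub>X\<^esub>)"
        using s0 fc x by (simp add: lft_def)
      then show "p x \<in> L \<longleftrightarrow> (\<forall>f\<in>lft ` Y. f x = \<zero>\<^bsub>M\<^esub>)" using Y(2) pc[OF x] by simp
    qed
    ultimately show ?thesis unfolding left_annihilator_def
      by (intro exI[of _ "lft ` Y"] conjI image_subsetI)
  qed
  show "acc_left_annihilators R X"
    unfolding acc_left_annihilators_def
  proof (intro allI impI)
    fix L assume L: "\<forall>n. left_annihilator R X (L n)" "\<forall>n. L n \<subseteq> L (Suc n)"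
    have acc: "acc_left_annihilators R M" using gd by (simp add: goldie_module_def)
    have "\<forall>n. left_annihilator R M (?v (L n))" using ann L(1) by blast
    moreover have "\<forall>n. ?v (L n) \<subseteq> ?v (L (Suc n))" using L(2) by blast
    ultimately have "\<exists>n. \<forall>m\<ge>n. ?v (L m) = ?v (L n)"
      using acc[unfolded acc_left_annihilators_def, rule_format, of "\<lambda>n. ?v (L n)"] by blast
    then obtain n where n: "\<forall>m\<ge>n. ?v (L m) = ?v (L n)" by blast
    \<comment> \<open>Since \<open>p\<close> is onto, each L m is recovered from its preimage, so
      stabilization in \<open>M\<close> gives stabilization in \<open>X\<close>.\<close>
    have img: "p ` ?v (L m) = L m" for m
    proof -
      have "L m \<subseteq> carrier X" using L(1)[rule_format, of m] unfolding left_annihilator_def by auto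
      then have "L m \<subseteq> p ` carrier M" by (simp add: p(2))
      then show ?thesis by blast
    qed
    have "L m = L n" if "m \<ge> n" for m
    proof -
      have "L m = p ` ?v (L m)" by (rule img[symmetric])
      also have "?v (L m) = ?v (L n)" by (rule n[rule_format, OF that])
      also have "p ` ?v (L n) = L n" by (rule img)
      finally show ?thesis .
    qed
    then show "\<exists>n. \<forall>m\<ge>n. L m = L n" by blast
  qed
qed

text \<open>M/N is isomorphic to the complement \<open>C\<close>: \<open>s\<close> sends a coset to
  its representative in \<open>C\<close>, which exists because N + C is all of \<open>M\<close> and
  is unique because \<open>N\<close> and \<open>C\<close> meet in zero.\<close>

lemma quot_splits:
  assumes N: "submodule N R M" and C: "submodule C R M"
    and NC: "N \<inter> C = {\<zero>\<^bsub>M\<^esub>}" "N <+>\<^bsub>M\<^esub> C = carrier M"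
  obtains s where "lmod_map R (quot_module M N) M s" "inj_on s (carrier (quot_module M N))"
proof -
  have Nc: "n \<in> carrier M" if "n \<in> N" for n using that N by (auto simp: submodule_iff)
  have Cc: "c \<in> carrier M" if "c \<in> C" for c using that C by (auto simp: submodule_iff)
  have ex: "\<exists>c. c \<in> C \<and> x \<ominus>\<^bsub>M\<^esub> c \<in> N" if "x \<in> carrier M" for x
  proof -
    have "x \<in> N <+>\<^bsub>M\<^esub> C" using \<open>x \<in> carrier M\<close> NC(2) by simp
    then obtain n c where nc: "n \<in> N" "c \<in> C" "x = n \<oplus>\<^bsub>M\<^esub> c" unfolding mem_set_add by blast
    have "x \<ominus>\<^bsub>M\<^esub> c = n" using nc Nc Cc by (simp add: a_minus_def M.a_assoc M.r_neg)
    then show ?thesis using nc(1,2) by auto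
  qed
  have un: "c = d" if "c \<in> C" "d \<in> C" "N +>\<^bsub>M\<^esub> c = N +>\<^bsub>M\<^esub> d" for c d
  proof -
    have "c \<ominus>\<^bsub>M\<^esub> d \<in> N" using coset_eq_iff[OF N Cc Cc] that by blast
    moreover have "c \<ominus>\<^bsub>M\<^esub> d \<in> C" by (rule submodule_minus[OF C that(1,2)])
    ultimately have "c \<ominus>\<^bsub>M\<^esub> d = \<zero>\<^bsub>M\<^esub>" using NC(1) by blast
    then show ?thesis using minus_eq_zero_iff Cc that by blast
  qed
  let ?X = "quot_module M N"
  define s where "s X = (SOME c. c \<in> C \<and> N +>\<^bsub>M\<^esub> c = X)" for X
  have s: "s X \<in> C" "N +>\<^bsub>M\<^esub> s X = X" if "X \<in> carrier ?X" for X
  proof -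
    obtain x where x: "x \<in> carrier M" "X = N +>\<^bsub>M\<^esub> x" using \<open>X \<in> carrier ?X\<close> by (auto simp: quot_carrier)
    obtain c where "c \<in> C" "x \<ominus>\<^bsub>M\<^esub> c \<in> N" using ex[OF x(1)] by blast
    then have "c \<in> C \<and> N +>\<^bsub>M\<^esub> c = X" using coset_eq_iff[OF N Cc x(1), of c] x(2) by metis
    then have "s X \<in> C \<and> N +>\<^bsub>M\<^esub> s X = X" unfolding s_def by (rule someI)
    then show "s X \<in> C" "N +>\<^bsub>M\<^esub> s X = X" by simp_all
  qed
  interpret X: left_module R ?X by (rule left_module_quot[OF N])
  have "lmod_map R ?X M s"
  proof (rule lmod_mapI)
    fix X assume X: "X \<in> carrier ?X"
    show "s X \<in> carrier M" using s(1)[OF X] Cc by blast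
    fix Y assume Y: "Y \<in> carrier ?X"
    show "s (X \<oplus>\<^bsub>?X\<^esub> Y) = s X \<oplus>\<^bsub>M\<^esub> s Y"
    proof (rule un)
      show "s X \<oplus>\<^bsub>M\<^esub> s Y \<in> C" using s(1)[OF X] s(1)[OF Y] C by (simp add: submodule_iff)
      show "N +>\<^bsub>M\<^esub> s (X \<oplus>\<^bsub>?X\<^esub> Y) = N +>\<^bsub>M\<^esub> (s X \<oplus>\<^bsub>M\<^esub> s Y)"
        using quot_add[OF N Cc[OF s(1)[OF X]] Cc[OF s(1)[OF Y]]] 
          s(2)[OF X.M.a_closed[OF X Y]] s(2)[OF X] s(2)[OF Y] by metis
    qed (use s(1) X Y in simp)
  next
    fix r X assume r: "r \<in> carrier R" and X: "X \<in> carrier ?X"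
    show "s (r \<odot>\<^bsub>?X\<^esub> X) = r \<odot>\<^bsub>M\<^esub> s X"
    proof (rule un)
      show "r \<odot>\<^bsub>M\<^esub> s X \<in> C" using s(1)[OF X] C r by (simp add: submodule_iff)
      show "N +>\<^bsub>M\<^esub> s (r \<odot>\<^bsub>?X\<^esub> X) = N +>\<^bsub>M\<^esub> (r \<odot>\<^bsub>M\<^esub> s X)"
        using quot_smult[OF N Cc[OF s(1)[OF X]] r] s(2)[OF X.smult_closed[OF r X]] s(2)[OF X] by metis
    qed (use s(1) X r in simp)
  qed
  moreover have "inj_on s (carrier ?X)" using s(2) by (metis inj_onI)
  ultimately show thesis by (rule that)
qed

end

theorem corollary4p9:
  fixes R :: "('a, 'r) ring_scheme" and M :: "('a, 'b, 'm) module_scheme" and N :: "'b set"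
  assumes "ring R" and "left_module R M"
    and "projective_in_sigma R M"
    and "co_semisimple R M"
    and "goldie_module R M"
    and "fully_invariant R M N"
  shows "semiprime_module R (quot_module M N) \<and> goldie_module R (quot_module M N)"
proof
  interpret left_module R M by fact
  show "semiprime_module R (quot_module M N)" by (rule semiprime_quot[OF assms(3,4,6)])
  have N: "submodule N R M" using assms(6) by (simp add: fully_invariant_def)
  obtain C where "submodule C R M" "N \<inter> C = {\<zero>\<^bsub>M\<^esub>}" "N <+>\<^bsub>M\<^esub> C = carrier M"
    by (rule fully_invariant_complement[OF assms(3-6)])
  then obtain s where "lmod_map R (quot_module M N) M s" "inj_on s (carrier (quot_module M N))"
    by (rule quot_splits[OF N])
  \<comment> \<open>M/N is an image of \<open>M\<close> under the coset map and embeds in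
    \<open>M\<close> through \<open>s\<close>, as \<open>goldie_direct_summand\<close>
    requires.\<close>
  then show "goldie_module R (quot_module M N)"
    by (rule goldie_direct_summand[OF assms(5) left_module_quot[OF N] lmod_map_quot[OF N] quot_carrier[symmetric]])
qed

end
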